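(* Let $F(z)=\sum_{k=0}^\infty b_k z^k\in\mathcal{B}$ and let \[ R=\frac{1}{4\sqrt3}\sqrt{59-\sqrt{2713}}. \] Then for all $r$ with $R\le r\le 1/\sqrt3$, \[ (1-|b_1|^2)\sum_{k=1}^\infty k|b_k|^2r^{2k}\le \frac{27}{8}r^4. \] The inequality is sharp: equality holds for $F(z)=\frac{3\sqrt3}{4}z^2$.
   Context: $\mathbb{D}$ denotes the open unit disc. $\mathcal{B}$ is the class of functions $F$ analytic in $\mathbb{D}$ satisfying $|F'(z)|\le \frac{1}{1-|z|^2}$ for all $z\in\mathbb{D}$. For $F\in\mathcal{B}$ we write its Taylor expansion as $F(z)=\sum_{k=0}^\infty b_k z^k$. *)

theory Defs
  imports "HOL-Complex_Analysis.Complex_Analysis"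
begin

definition bloch_class :: "(complex \<Rightarrow> complex) set" where
  "bloch_class = {F. F holomorphic_on ball 0 1 \<and>
      (\<forall>z\<in>ball 0 1. norm (deriv F z) \<le> 1 / (1 - (norm z)^2))}"

definition taylor_coeff :: "(complex \<Rightarrow> complex) \<Rightarrow> nat \<Rightarrow> complex" where
  "taylor_coeff F k = (deriv ^^ k) F 0 / of_nat (fact k)"

definition bloch_sum :: "(complex \<Rightarrow> complex) \<Rightarrow> real \<Rightarrow> real" where
  "bloch_sum F r = (1 - (norm (taylor_coeff F 1))^2) *
      (\<Sum>k. real (Suc k) * (norm (taylor_coeff F (Suc k)))^2 * r ^ (2 * Suc k))"

end

theory Submission
  imports Defs
begin

text \<open>
  Put \<open>g(Z) = (2/3) F'(Z / sqrt 3)\<close> and \<open>s = 3 r^2\<close>. The claim becomes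
  \<open>(1 - (9/4) |g_0|^2) * (SUM k. |g_k|^2 s^k / (k+1)) \<le> s/2\<close>, and since the left-hand side is convex in
  \<open>s\<close> it suffices to treat \<open>s = 1\<close> and the critical value \<open>s0 = 3 R^2\<close>, a root of \<open>8 s^2 - 59 s + 24\<close>.
  Write \<open>|g_0| = 3q(1 - 3q^2)\<close>. Among the functions with this \<open>|g_0|\<close> the natural competitor is the
  Moebius translate of \<open>z^2\<close>, whose \<open>g\<close> is \<open>(1 - 3q^2)(Z - 3q)/(1 - qZ)^3\<close>; the polynomial
  \<open>8 s^2 - 59 s + 24\<close> is, up to a positive factor, the \<open>q^2\<close>-coefficient of the claim for this family.

  Transporting \<open>F\<close> by the same disc automorphism gives a self-map of the unit disc, and the Schwarz lemma
  bounds \<open>|g_1|\<close> by its value for the competitor, with a defect \<open>e \<ge> 0\<close>. If \<open>q\<close> or \<open>e/q^2\<close> is not small, this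
  and \<open>SUM k. |g_k|^2 \<le> 1\<close> already suffice. Otherwise \<open>g\<close> differs from the competitor by \<open>O(e)\<close> uniformly on
  \<open>|Z| \<le> 2/3\<close>, so all coefficients are known up to \<open>O(e)\<close>; the terms of order \<open>q^2\<close> cancel at \<open>s0\<close>, the gain
  in \<open>|g_1|^2\<close> absorbs the terms linear in \<open>e\<close>, and the terms of order \<open>q^4\<close> have the right sign.
\<close>

section \<open>Bessel's inequality and the Schwarz lemma\<close>

lemma root_of_unity_orthogonality:
  fixes k l N :: nat
  assumes "k < N" "l < N"
  defines "w \<equiv> exp (2 * of_real pi * \<i> / of_nat N)"
  shows "(\<Sum>j<N. (w ^ k * cnj w ^ l) ^ j) = (if k = l then of_nat N else 0)"
proof -
  have N: "1 \<le> N" using assms by simp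
  have wk: "w ^ j = exp (2 * of_real pi * \<i> * of_nat j / of_nat N)" for j
    unfolding w_def by (simp flip: exp_of_nat_mult add: field_simps)
  have ww: "w * cnj w = 1"
    by (simp add: w_def exp_cnj flip: exp_add)
  have wl: "w ^ l * cnj w ^ l = 1"
    by (simp add: ww flip: power_mult_distrib)
  have wN: "w ^ N = 1"
    using N by (simp add: wk)
  have cN: "cnj w ^ N = 1"
    using arg_cong[OF wN, of cnj] by simp
  let ?x = "w ^ k * cnj w ^ l"
  have xN: "?x ^ N = 1"
    by (simp add: power_mult_distrib wN cN flip: power_mult add: mult.commute[of _ N])
       (simp add: power_mult wN cN)
  show ?thesis
  proof (cases "k = l")
    case True
    then show ?thesis using wl by simp
  next
    case False
    have "?x \<noteq> 1"
    proof
      assume x1: "?x = 1"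
      have "w ^ k = ?x * w ^ l" using wl by (simp add: mult_ac)
      hence "w ^ k = w ^ l" using x1 by simp
      hence "k mod N = l mod N"
        unfolding wk using complex_root_unity_eq[OF N] by blast
      thus False using assms False by simp
    qed
    then show ?thesis using False xN by (simp add: sum_gp_strict)
  qed
qed

lemma discrete_parseval:
  fixes b :: "nat \<Rightarrow> complex"
  assumes "N > 0"
  defines "w \<equiv> exp (2 * of_real pi * \<i> / of_nat N)"
  shows "(\<Sum>j<N. (norm (\<Sum>k<N. b k * (w ^ j) ^ k))^2) = real N * (\<Sum>k<N. (norm (b k))^2)"
proof -
  have "complex_of_real (\<Sum>j<N. (norm (\<Sum>k<N. b k * (w ^ j) ^ k))^2) =
        (\<Sum>j<N. \<Sum>k<N. \<Sum>l<N. b k * cnj (b l) * (w ^ k * cnj w ^ l) ^ j)"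
    unfolding of_real_sum complex_norm_square cnj_sum sum_product
    by (simp add: mult_ac power_mult_distrib flip: power_mult)
  also have "\<dots> = (\<Sum>k<N. \<Sum>l<N. \<Sum>j<N. b k * cnj (b l) * (w ^ k * cnj w ^ l) ^ j)"
    by (subst sum.swap, rule sum.cong[OF refl], rule sum.swap)
  also have "\<dots> = (\<Sum>k<N. \<Sum>l<N. b k * cnj (b l) * (if k = l then of_nat N else 0))"
    unfolding sum_distrib_left[symmetric]
    by (intro sum.cong refl)
       (use root_of_unity_orthogonality[where N = N, folded w_def] in \<open>simp only: lessThan_iff\<close>)
  also have "\<dots> = (\<Sum>k<N. of_nat N * (b k * cnj (b k)))"
    by (intro sum.cong refl) (simp add: if_distrib sum.delta mult_ac cong: if_cong)
  also have "\<dots> = complex_of_real (real N * (\<Sum>k<N. (norm (b k))^2))"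
    by (simp only: of_real_mult of_real_sum complex_norm_square sum_distrib_left of_real_of_nat_eq)
  finally show ?thesis by (simp only: of_real_eq_iff)
qed

lemma taylor_coeff_sums:
  assumes "f holomorphic_on ball 0 R" "norm z < R"
  shows "(\<lambda>k. taylor_coeff f k * z ^ k) sums f z"
  using holomorphic_power_series[OF assms(1), of z] assms(2) by (simp add: taylor_coeff_def)

text \<open>Averages over \<open>N\<close> equally spaced points replace the integral over the
  circle: the Taylor polynomial of degree below \<open>N\<close> satisfies Parseval exactly, and on
  the circle it differs from \<open>f\<close> by at most the tail \<open>t N\<close> of an
  absolutely convergent series, which tends to 0.\<close>

lemma taylor_coeff_bessel:
  assumes hol: "f holomorphic_on ball 0 R" and \<rho>: "0 \<le> \<rho>" "\<rho> < R"
    and M: "\<And>z. norm z = \<rho> \<Longrightarrow> norm (f z) \<le> M"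
  shows "(\<Sum>k<n. (norm (taylor_coeff f k))^2 * \<rho> ^ (2 * k)) \<le> M^2"
proof -
  define c where "c k = norm (taylor_coeff f k) * \<rho> ^ k" for k
  \<comment> \<open>Convergence at the midpoint of \<open>\<rho>\<close> and \<open>R\<close> gives
    absolute convergence on the circle of radius \<open>\<rho>\<close>.\<close>
  have "summable (\<lambda>k. taylor_coeff f k * of_real ((\<rho> + R) / 2) ^ k)"
    using taylor_coeff_sums[OF hol, of "of_real ((\<rho> + R) / 2)"] \<rho>
    by (auto simp: sums_iff simp flip: of_real_add)
  from powser_insidea[OF this, of "of_real \<rho>"] have sm: "summable c"
    using \<rho> by (simp add: c_def[abs_def] norm_mult norm_power flip: of_real_add)
  define t where "t N = (\<Sum>k. c (k + N))" for N
  have t0: "t \<longlonglongrightarrow> 0"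
    unfolding t_def using suminf_exist_split2[OF sm] by simp
  have partial: "norm (\<Sum>k<N. taylor_coeff f k * z ^ k) \<le> M + t N" if z: "norm z = \<rho>" for z N
  proof -
    have s: "(\<lambda>k. taylor_coeff f k * z ^ k) sums f z"
      using taylor_coeff_sums[OF hol, of z] z \<rho> by simp
    have sN: "summable (\<lambda>k. norm (taylor_coeff f (k + N) * z ^ (k + N)))"
      using sm z unfolding c_def[abs_def] 
      by (subst summable_iff_shift[of "\<lambda>k. norm (taylor_coeff f k * z ^ k)"]) (simp add: norm_mult norm_power)
    have "(\<Sum>k<N. taylor_coeff f k * z ^ k) = f z - (\<Sum>k. taylor_coeff f (k + N) * z ^ (k + N))"
      using suminf_split_initial_segment[OF sums_summable[OF s], of N] sums_unique[OF s]
      by (simp add: algebra_simps)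
    also have "norm \<dots> \<le> norm (f z) + norm (\<Sum>k. taylor_coeff f (k + N) * z ^ (k + N))"
      by (rule norm_triangle_ineq4)
    also have "norm (\<Sum>k. taylor_coeff f (k + N) * z ^ (k + N)) \<le> (\<Sum>k. norm (taylor_coeff f (k + N) * z ^ (k + N)))"
      by (rule summable_norm[OF sN])
    also have "\<dots> = t N"
      unfolding t_def c_def using z by (simp add: norm_mult norm_power)
    finally show ?thesis using M[OF z] by simp
  qed
  have bound: "(\<Sum>k<n. (c k)^2) \<le> (M + t N)^2" if N: "N > n" for N
  proof -
    define w where "w = exp (2 * of_real pi * \<i> / of_nat N)"
    define b where "b k = taylor_coeff f k * of_real \<rho> ^ k" for k
    have nw: "norm (w ^ j) = 1" for j
      by (simp add: w_def norm_power norm_exp_eq_Re)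
    have "real N * (\<Sum>k<N. (norm (b k))^2) = (\<Sum>j<N. (norm (\<Sum>k<N. b k * (w ^ j) ^ k))^2)"
      using discrete_parseval[of N b] N unfolding w_def by simp
    also have "\<dots> \<le> (\<Sum>j<N. (M + t N)^2)"
    proof (intro sum_mono power_mono norm_ge_zero)
      fix j
      have "(\<Sum>k<N. b k * (w ^ j) ^ k) = (\<Sum>k<N. taylor_coeff f k * (of_real \<rho> * w ^ j) ^ k)"
        by (simp add: b_def power_mult_distrib mult_ac)
      thus "norm (\<Sum>k<N. b k * (w ^ j) ^ k) \<le> M + t N"
        using partial[of "of_real \<rho> * w ^ j" N] nw \<rho> by (simp add: norm_mult)
    qed
    finally have "(\<Sum>k<N. (norm (b k))^2) \<le> (M + t N)^2"
      using N by simp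
    moreover have "norm (b k) = c k" for k using \<rho> by (simp add: b_def c_def norm_mult norm_power)
    moreover have "(\<Sum>k<n. (c k)^2) \<le> (\<Sum>k<N. (c k)^2)"
      using N by (intro sum_mono2) auto
    ultimately show ?thesis by simp
  qed
  have "(\<lambda>N. (M + t N)^2) \<longlonglongrightarrow> (M + 0)^2"
    by (intro tendsto_intros t0)
  hence "(\<Sum>k<n. (c k)^2) \<le> (M + 0)^2"
    by (rule tendsto_lowerbound) (use bound in \<open>auto simp: eventually_at_top_dense\<close>)
  thus ?thesis by (simp add: c_def power_mult_distrib power_mult mult.commute[of 2] flip: power_mult)
qed

section \<open>A Schwarz-lemma bound for functions close to 1\<close>

text \<open>\<open>1 - h\<close> takes values in the right half-plane and equals
  \<open>1 - x\<close> at 0. A Cayley transform sending \<open>1 - x\<close> to 0 makes the Schwarz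
  lemma applicable, and solving for \<open>|1 - h z|\<close> gives the factor. The point is that the
  bound is linear in \<open>1 - x\<close>.\<close>

lemma norm_one_minus_le:
  assumes hol: "h holomorphic_on ball 0 1" and le: "\<And>z. norm z < 1 \<Longrightarrow> norm (h z) \<le> 1"
    and h0: "h 0 = of_real x" and z: "norm z < 1"
  shows "norm (1 - h z) \<le> (1 - x) * ((1 + norm z) / (1 - norm z))"
proof -
  define C where "C = (1 + norm z) / (1 - norm z)"
  have strict: "norm (1 - f z) \<le> (1 - y) * C"
    if hf: "f holomorphic_on ball 0 1" and lt: "\<And>z. norm z < 1 \<Longrightarrow> norm (f z) < 1"
      and f0: "f 0 = of_real y" for f y
  proof -
    define e where "e = 1 - y"
    have y: "y < 1" using lt[of 0] f0 by simp
    hence e: "e > 0" by (simp add: e_def)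
    define k where "k z = (1 - f z - of_real e) / (1 - f z + of_real e)" for z
    have sq: "(norm (u + of_real e))^2 - (norm (u - of_real e))^2 = 4 * Re u * e" for u
      unfolding cmod_power2 by (simp add: power2_eq_square algebra_simps)
    have rp: "Re (1 - f z) > 0" if "norm z < 1" for z
      using lt[OF that] complex_Re_le_cmod[of "f z"] by simp
    have nz: "1 - f z + of_real e \<noteq> 0" if "norm z < 1" for z
      using rp[OF that] e by (auto simp: complex_eq_iff)
    have kz: "norm (k z) \<le> norm z"
    proof (rule Schwarz_Lemma(1)[OF _ _ _ z])
      show "k holomorphic_on ball 0 1"
        unfolding k_def using hf nz by (intro holomorphic_intros) auto
      show "k 0 = 0" by (simp add: k_def f0 e_def)
      fix z :: complex assume z: "norm z < 1"
      have "(norm (1 - f z + of_real e))^2 > (norm (1 - f z - of_real e))^2"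
        using sq[of "1 - f z"] mult_pos_pos[OF rp[OF z] e] by linarith
      hence "norm (1 - f z - of_real e) < norm (1 - f z + of_real e)"
        by (rule power2_less_imp_less) simp
      thus "norm (k z) < 1"
        by (simp add: k_def norm_divide divide_less_eq_1)
    qed
    have "norm (1 - f z) - e \<le> norm (1 - f z - of_real e)"
      using norm_triangle_ineq2[of "1 - f z" "of_real e"] e by simp
    also have "\<dots> = norm (k z) * norm (1 - f z + of_real e)"
      using nz[OF z] by (simp add: k_def norm_divide)
    also have "\<dots> \<le> norm z * (norm (1 - f z) + e)"
      using kz norm_triangle_ineq[of "1 - f z" "of_real e"] e by (intro mult_mono) auto
    finally have "norm (1 - f z) * (1 - norm z) \<le> e * (1 + norm z)" by (simp add: algebra_simps)
    thus ?thesis using z by (simp add: C_def e_def field_simps)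
  qed
  \<comment> \<open>The transform requires \<open>|h| < 1\<close>, so it is applied to
    \<open>(1 - d) * h\<close> and \<open>d\<close> then tends to 0.\<close>
  have "norm (1 - of_real (1 - d) * h z) \<le> (1 - (1 - d) * x) * C" if d: "0 < d" "d < 1" for d
  proof (rule strict[of "\<lambda>z. of_real (1 - d) * h z"])
    show "(\<lambda>z. of_real (1 - d) * h z) holomorphic_on ball 0 1" using hol by (intro holomorphic_intros) auto
    fix z :: complex assume "norm z < 1"
    have "norm (of_real (1 - d) * h z) = (1 - d) * norm (h z)"
      using d by (simp only: norm_mult norm_of_real)
    also have "\<dots> \<le> (1 - d) * 1" using le[OF \<open>norm z < 1\<close>] d by (intro mult_left_mono) auto
    finally show "norm (of_real (1 - d) * h z) < 1" using d by simp
  qed (simp add: h0)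
  hence "\<forall>\<^sub>F d in at_right 0. norm (1 - of_real (1 - d) * h z) \<le> (1 - (1 - d) * x) * C"
    by (auto simp: eventually_at_right_field intro!: exI[of _ 1])
  moreover have "((\<lambda>d. norm (1 - of_real (1 - d) * h z)) \<longlongrightarrow> norm (1 - of_real (1 - 0) * h z)) (at_right 0)"
    by (intro tendsto_intros)
  moreover have "((\<lambda>d. (1 - (1 - d) * x) * C) \<longlongrightarrow> (1 - (1 - 0) * x) * C) (at_right 0)"
    by (intro tendsto_intros)
  ultimately have "norm (1 - of_real (1 - 0) * h z) \<le> (1 - (1 - 0) * x) * C"
    by (intro tendsto_le[of "at_right (0::real)"]) auto
  thus ?thesis by (simp add: C_def)
qed

section \<open>The inequality for coefficient sequences\<close>

text \<open>Convexity of \<open>t ^ k\<close> along the chord from \<open>a\<close> to 1; it later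
  reduces a whole interval of \<open>s\<close> to its two endpoints.\<close>

lemma convex_combination_power_le:
  fixes a b :: real
  assumes "0 \<le> a" "a \<le> 1" "0 \<le> b" "b \<le> 1"
  shows "((1 - b) * a + b) ^ k \<le> (1 - b) * a ^ k + b"
proof (induction k)
  case (Suc k)
  have "((1 - b) * a + b) ^ Suc k \<le> ((1 - b) * a + b) * ((1 - b) * a ^ k + b)"
    using assms Suc by (auto intro!: mult_left_mono add_nonneg_nonneg)
  also have "\<dots> = (1 - b) * a ^ Suc k + b - b * (1 - b) * ((1 - a) * (1 - a ^ k))"
    by (simp add: algebra_simps)
  also have "\<dots> \<le> (1 - b) * a ^ Suc k + b"
    using assms by (simp add: power_le_one)
  finally show ?case .
qed simp

text \<open>From index 2 on the weight \<open>s ^ k / (k + 1)\<close> is at most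
  \<open>s^2 / 3\<close>, and Bessel leaves at most \<open>1 - (c 0)^2 - (c 1)^2\<close> for these
  indices.\<close>

lemma sum_le_first_two:
  fixes c :: "nat \<Rightarrow> real"
  assumes c: "\<And>n. (\<Sum>k<n. (c k)\<^sup>2) \<le> 1" and s: "0 \<le> s" "s \<le> 1"
  shows "(\<Sum>k<N. (c k)\<^sup>2 * s ^ k / real (Suc k)) \<le>
         (c 0)\<^sup>2 + s / 2 * (c 1)\<^sup>2 + s\<^sup>2 / 3 * (1 - (c 0)\<^sup>2 - (c 1)\<^sup>2)"
proof -
  have "(\<Sum>k<N. (c k)\<^sup>2 * s ^ k / real (Suc k)) \<le> (\<Sum>k<Suc (Suc N). (c k)\<^sup>2 * s ^ k / real (Suc k))"
    using s by (intro sum_mono2) auto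
  also have "\<dots> = (c 0)\<^sup>2 + s / 2 * (c 1)\<^sup>2 + (\<Sum>k<N. (c (Suc (Suc k)))\<^sup>2 * s ^ Suc (Suc k) / real (Suc (Suc (Suc k))))"
    unfolding sum.lessThan_Suc_shift by simp
  also have "(\<Sum>k<N. (c (Suc (Suc k)))\<^sup>2 * s ^ Suc (Suc k) / real (Suc (Suc (Suc k)))) \<le>
      (\<Sum>k<N. (c (Suc (Suc k)))\<^sup>2 * (s\<^sup>2 / 3))"
  proof (rule sum_mono)
    fix k
    have "s ^ Suc (Suc k) / real (Suc (Suc (Suc k))) \<le> s\<^sup>2 / 3"
    proof (rule frac_le)
      show "s ^ Suc (Suc k) \<le> s\<^sup>2" using s by (intro power_decreasing) auto
    qed (use s in auto)
    from mult_left_mono[OF this, of "(c (Suc (Suc k)))\<^sup>2"]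
    show "(c (Suc (Suc k)))\<^sup>2 * s ^ Suc (Suc k) / real (Suc (Suc (Suc k))) \<le> (c (Suc (Suc k)))\<^sup>2 * (s\<^sup>2 / 3)" by simp
  qed
  also have "\<dots> = s\<^sup>2 / 3 * ((\<Sum>k<Suc (Suc N). (c k)\<^sup>2) - (c 0)\<^sup>2 - (c 1)\<^sup>2)"
    by (simp add: sum.lessThan_Suc_shift sum_distrib_left sum_distrib_right mult_ac del: sum.lessThan_Suc)
  also have "\<dots> \<le> s\<^sup>2 / 3 * (1 - (c 0)\<^sup>2 - (c 1)\<^sup>2)"
    using c[of "Suc (Suc N)"] by (intro mult_left_mono) auto
  finally show ?thesis by simp
qed

text \<open>Refined version: index 2 keeps its own term, and the tail from index 3, where
  \<open>1 / (k + 1)\<close> is at most 1/4, is measured at the larger parameter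
  \<open>t\<close>.\<close>

lemma sum_le_first_three:
  fixes c :: "nat \<Rightarrow> real"
  assumes c: "\<And>n. (\<Sum>k<n. (c (k + 3))\<^sup>2 * t ^ (k + 3)) \<le> T" and s: "0 \<le> s" "s \<le> t"
  shows "(\<Sum>k<N. (c k)\<^sup>2 * s ^ k / real (Suc k)) \<le>
         (c 0)\<^sup>2 + s / 2 * (c 1)\<^sup>2 + s\<^sup>2 / 3 * (c 2)\<^sup>2 + T / 4"
proof -
  have "(\<Sum>k<N. (c k)\<^sup>2 * s ^ k / real (Suc k)) \<le> (\<Sum>k<Suc (Suc (Suc N)). (c k)\<^sup>2 * s ^ k / real (Suc k))"
    using s by (intro sum_mono2) auto
  also have "\<dots> = (c 0)\<^sup>2 + s / 2 * (c 1)\<^sup>2 + s\<^sup>2 / 3 * (c 2)\<^sup>2 + (\<Sum>k<N. (c (k + 3))\<^sup>2 * s ^ (k + 3) / real (k + 4))"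
    unfolding sum.lessThan_Suc_shift by (simp add: eval_nat_numeral algebra_simps)
  also have "(\<Sum>k<N. (c (k + 3))\<^sup>2 * s ^ (k + 3) / real (k + 4)) \<le> (\<Sum>k<N. (c (k + 3))\<^sup>2 * t ^ (k + 3) / 4)"
    using s by (intro sum_mono frac_le mult_left_mono power_mono) auto
  also have "\<dots> \<le> T / 4"
    using c[of N] by (simp flip: sum_divide_distrib)
  finally show ?thesis by simp
qed

text \<open>Here \<open>u\<close> and \<open>X\<close> stand for \<open>|g_0|^2\<close> and
  \<open>|g_1|^2\<close>. The left side minus \<open>s / 2\<close> is a combination of
  \<open>u\<close> and the deficit \<open>1 - X\<close>; a lower bound \<open>\<tau> * u\<close> for
  the deficit makes everything proportional to \<open>u\<close>, and dividing by \<open>u\<close>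
  leaves \<open>key\<close>.\<close>

lemma crude_estimate:
  fixes u X s \<tau> :: real
  assumes X: "\<tau> * u \<le> 1 - X" and u: "0 \<le> u" "9 / 4 * u \<le> 1" and s: "0 \<le> s" "s \<le> 1"
    and key: "(1 - s\<^sup>2 / 3 - (s / 2 - s\<^sup>2 / 3) * \<tau>) * (1 - 9 / 4 * u) \<le> 9 / 8 * s"
  shows "(1 - 9 / 4 * u) * (u + s / 2 * X + s\<^sup>2 / 3 * (1 - u - X)) \<le> s / 2"
proof -
  define c where "c = s / 2 - s\<^sup>2 / 3"
  have "s * s \<le> s * 1" using s by (intro mult_left_mono) auto
  hence c: "c \<ge> 0" using s by (simp add: c_def power2_eq_square)
  have "(1 - s\<^sup>2 / 3) * u - c * (1 - X) \<le> (1 - s\<^sup>2 / 3) * u - c * (\<tau> * u)"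
    using mult_left_mono[OF X c] by simp
  hence "(1 - 9 / 4 * u) * ((1 - s\<^sup>2 / 3) * u - c * (1 - X)) \<le> (1 - 9 / 4 * u) * ((1 - s\<^sup>2 / 3) * u - c * (\<tau> * u))"
    using u by (intro mult_left_mono) auto
  also have "\<dots> = u * ((1 - s\<^sup>2 / 3 - c * \<tau>) * (1 - 9 / 4 * u))" by (simp add: algebra_simps)
  also have "\<dots> \<le> u * (9 / 8 * s)" using key u unfolding c_def by (intro mult_left_mono) auto
  finally have "(1 - 9 / 4 * u) * ((1 - s\<^sup>2 / 3) * u - c * (1 - X)) \<le> u * (9 / 8 * s)" .
  moreover have "(1 - 9 / 4 * u) * (u + s / 2 * X + s\<^sup>2 / 3 * (1 - u - X)) =
     (1 - 9 / 4 * u) * ((1 - s\<^sup>2 / 3) * u - c * (1 - X)) + s / 2 - u * (9 / 8 * s)"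
    by (simp add: c_def field_simps)
  ultimately show ?thesis by linarith
qed

text \<open>The competitor has \<open>|g_0|^2 = u\<close> and
  \<open>|g_1| = (1 - 3q^2)(1 - 9q^2)\<close>. The factor \<open>8 / 3 - 6 * q^2\<close> makes both
  sides agree up to order \<open>q^6\<close>, and it serves as \<open>\<tau>\<close> in the crude
  estimate.\<close>

lemma extremal_deficit:
  fixes q u :: real
  defines "u \<equiv> (3 * q * (1 - 3 * q\<^sup>2))\<^sup>2"
  assumes "q\<^sup>2 \<le> 1 / 9"
  shows "(8 / 3 - 6 * q\<^sup>2) * u \<le> 1 - ((1 - 3 * q\<^sup>2) * (1 - 9 * q\<^sup>2))\<^sup>2"
proof -
  have "1 - ((1 - 3 * q\<^sup>2) * (1 - 9 * q\<^sup>2))\<^sup>2 - (8 / 3 - 6 * q\<^sup>2) * u = 27 * q ^ 6 * (4 - 9 * q\<^sup>2)"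
    unfolding u_def by algebra
  moreover have "27 * q ^ 6 * (4 - 9 * q\<^sup>2) \<ge> 0" using assms by simp
  ultimately show ?thesis by linarith
qed

text \<open>All that the real-variable argument uses about \<open>g\<close>, with
  \<open>c k = |g_k|\<close>. For \<open>e = 0\<close> the formula for \<open>c 1\<close> and the
  main term for \<open>c 2\<close> are the competitor's values. The number 4/9 is the square of the
  radius 2/3 and exceeds the critical \<open>s\<close>, so \<open>tail\<close> controls the tail
  there.\<close>

locale coefficient_bounds =
  fixes c :: "nat \<Rightarrow> real" and q e :: real
  assumes sum_le: "(\<Sum>k<n. (c k)\<^sup>2) \<le> 1"
    and q: "0 \<le> q" "q < 1 / 3" and e: "0 \<le> e"
    and c0: "c 0 = 3 * q * (1 - 3 * q\<^sup>2)"
    and c1: "c 1 = (1 - 3 * q\<^sup>2) * (1 - 9 * q\<^sup>2) - (1 - 3 * q\<^sup>2)\<^sup>2 * e"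
    and c_nonneg: "c k \<ge> 0"
    and c2: "q \<le> 7 / 100 \<Longrightarrow> c 2 \<le> 3 * q * (1 - 3 * q\<^sup>2) * (1 - 6 * q\<^sup>2) + 94 / 10 * e"
    and tail: "q \<le> 7 / 100 \<Longrightarrow> (\<Sum>k<n. (c (k + 3))\<^sup>2 * (4 / 9) ^ (k + 3)) \<le> (19 / 2 * e + 3 * q\<^sup>2)\<^sup>2"
begin

definition "Q = q\<^sup>2"
definition "u = (c 0)\<^sup>2"
text \<open>The competitor's value of \<open>c 1\<close>, not of \<open>c 0\<close>.\<close>

definition "g0 = (1 - 3 * Q) * (1 - 9 * Q)"

lemma Q: "0 \<le> Q" "Q < 1 / 9"
  using q power_strict_mono[of q "1/3" 2] by (auto simp: power_divide Q_def)

lemma u_eq: "u = 9 * Q * (1 - 3 * Q)\<^sup>2"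
  by (simp add: u_def c0 power_mult_distrib Q_def)

lemma u_bounds: "0 \<le> u" "9 / 4 * u \<le> 1" "u \<le> 9 * Q" "9 * Q * (1 - 6 * Q) \<le> u"
proof -
  show "0 \<le> u" by (simp add: u_def)
  \<comment> \<open>The double zero at \<open>Q = 1 / 9\<close> corresponds to
    \<open>|F'(0)| = 1\<close>.\<close>
  have 1: "1 - 81 / 4 * Q * (1 - 3 * Q)\<^sup>2 = (1 - 9 * Q)\<^sup>2 * (1 - 9 / 4 * Q)" by algebra
  have "(1 - 9 * Q)\<^sup>2 * (1 - 9 / 4 * Q) \<ge> 0" using Q by simp
  thus "9 / 4 * u \<le> 1" using 1 by (simp add: u_eq)
  have "(1 - 3 * Q)\<^sup>2 \<le> 1\<^sup>2" using Q by (intro power_mono) auto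
  from mult_left_mono[OF this, of "9 * Q"] show "u \<le> 9 * Q" using Q by (simp add: u_eq)
  have "1 - 6 * Q \<le> (1 - 3 * Q)\<^sup>2"
    using zero_le_power2[of "3 * Q"] by (simp add: power2_diff)
  from mult_left_mono[OF this, of "9 * Q"] show "9 * Q * (1 - 6 * Q) \<le> u" using Q by (simp add: u_eq)
qed

lemma g0_ge: "1 - 12 * Q \<le> g0"
proof -
  have "g0 = 1 - 12 * Q + 27 * (Q * Q)" by (simp add: g0_def algebra_simps)
  thus ?thesis by simp
qed

lemma c1_eq: "c 1 = g0 - (1 - 3 * Q)\<^sup>2 * e"
  using c1 by (simp add: g0_def Q_def)

lemma deficit: "(8 / 3 - 6 * Q) * u \<le> 1 - g0\<^sup>2"
  unfolding u_def g0_def c0 Q_def by (rule extremal_deficit) (use Q in \<open>simp add: Q_def\<close>)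

lemma c1_sq_le: "0 \<le> d \<Longrightarrow> d \<le> (1 - 3 * Q)\<^sup>2 * e \<Longrightarrow> (c 1)\<^sup>2 \<le> (g0 - d)\<^sup>2"
  using c_nonneg[of 1] c1_eq by (intro power_mono) linarith+

lemma c01: "(c 0)\<^sup>2 + (c 1)\<^sup>2 \<le> 1"
  using sum_le[of 2] by (simp add: eval_nat_numeral)

text \<open>At \<open>s = 1\<close> there is room to spare: Bessel alone suffices, since with
  \<open>\<tau> = 0\<close> the condition \<open>key\<close> only asks that 2/3 times a number at
  most 1 be below 9/8.\<close>

lemma partial_sum_at_one: "(1 - 9 / 4 * u) * (\<Sum>k<N. (c k)\<^sup>2 * 1 ^ k / real (Suc k)) \<le> 1 / 2"
proof -
  have "(1 - 9 / 4 * u) * (\<Sum>k<N. (c k)\<^sup>2 * 1 ^ k / real (Suc k)) \<le>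
        (1 - 9 / 4 * u) * (u + 1 / 2 * (c 1)\<^sup>2 + 1\<^sup>2 / 3 * (1 - u - (c 1)\<^sup>2))"
    using sum_le_first_two[of c 1 N] sum_le u_bounds by (intro mult_left_mono) (auto simp: u_def)
  also have "\<dots> \<le> 1 / 2"
  proof (rule crude_estimate[where \<tau> = 0])
    show "0 * u \<le> 1 - (c 1)\<^sup>2" using c01 zero_le_power2[of "c 0"] by linarith
    show "(1 - 1\<^sup>2 / 3 - (1 / 2 - 1\<^sup>2 / 3) * 0) * (1 - 9 / 4 * u) \<le> 9 / 8 * 1" using u_bounds by simp
  qed (use u_bounds in auto)
  finally show ?thesis .
qed

text \<open>At the critical \<open>s\<close> and \<open>Q = 0\<close> the crude estimate with
  \<open>\<tau> = 8 / 3\<close> fails by a fixed margin. For \<open>Q \<ge> (7 / 100)^2\<close> the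
  factor \<open>1 - 9 / 4 * u\<close> makes up for it; for \<open>e \<ge> 4 / 3 * Q\<close> the
  further drop of \<open>c 1\<close> does, by raising \<open>\<tau>\<close>.\<close>

lemma critical_crude:
  assumes s: "s\<^sup>2 = (59 * s - 24) / 8" "432 / 1000 \<le> s" "s \<le> 4321 / 10000"
    and large: "49 / 10000 \<le> Q \<or> 4 / 3 * Q \<le> e"
  shows "(1 - 9 / 4 * u) * (u + s / 2 * (c 1)\<^sup>2 + s\<^sup>2 / 3 * (1 - u - (c 1)\<^sup>2)) \<le> s / 2"
proof -
  have v: "0 \<le> 1 - 9 / 4 * u" "1 - 9 / 4 * u \<le> 1 - 81 / 4 * Q + 243 / 2 * (Q * Q)"
    using u_bounds(2,4) by (simp_all add: algebra_simps)
  have QQ: "0 \<le> Q * Q" by simp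
  define w where "w = s / 2 - s\<^sup>2 / 3"
  \<comment> \<open>The quadratic equation for \<open>s\<close> makes the weight of the deficit
    linear in \<open>s\<close>.\<close>
  have w_eq: "w = 1 - 47 / 24 * s" unfolding w_def s(1) by (simp add: field_simps)
  have wQ: "w * Q \<le> 154 / 1000 * Q" using s Q by (intro mult_right_mono) (auto simp: w_eq)
  show ?thesis
  proof (cases "49 / 10000 \<le> Q")
    case True
    show ?thesis
    proof (rule crude_estimate[where \<tau> = "8 / 3 - 6 * Q"])
      show "(8 / 3 - 6 * Q) * u \<le> 1 - (c 1)\<^sup>2"
        using deficit c1_sq_le[of 0] e by simp
      \<comment> \<open>\<open>Q * Q\<close> lies below its chord over the interval from 49/10000 to
        1/9, which linearises the bound on \<open>1 - 9 / 4 * u\<close>.\<close>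
      have "(Q - 49 / 10000) * (1 / 9 - Q) \<ge> 0" using True Q by simp
      hence v2: "1 - 9 / 4 * u \<le> 934 / 1000 - 615 / 100 * Q"
        using v(2) Q True unfolding left_diff_distrib right_diff_distrib by linarith
      have "1 - s\<^sup>2 / 3 - w * (8 / 3 - 6 * Q) = (1 - s\<^sup>2 / 3 - 8 / 3 * w) + 6 * (w * Q)"
        by (simp add: algebra_simps)
      moreover have "1 - s\<^sup>2 / 3 - 8 / 3 * w \<le> 528 / 1000" unfolding s(1) w_eq using s(3) by (simp add: field_simps)
      moreover have "6 * (w * Q) \<le> 924 / 1000 * Q" using wQ by simp
      ultimately have "1 - s\<^sup>2 / 3 - (s / 2 - s\<^sup>2 / 3) * (8 / 3 - 6 * Q) \<le> 528 / 1000 + 924 / 1000 * Q"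
        unfolding w_def[symmetric] by linarith
      hence "(1 - s\<^sup>2 / 3 - (s / 2 - s\<^sup>2 / 3) * (8 / 3 - 6 * Q)) * (1 - 9 / 4 * u)
             \<le> (528 / 1000 + 924 / 1000 * Q) * (934 / 1000 - 615 / 100 * Q)"
        using v v2 Q by (intro mult_mono) auto
      also have "\<dots> = 493152 / 1000000 - 2384184 / 1000000 * Q - 56826 / 10000 * (Q * Q)"
        by (simp add: algebra_simps)
      also have "\<dots> \<le> 9 / 8 * s" using True QQ s(2) by linarith
      finally show "(1 - s\<^sup>2 / 3 - (s / 2 - s\<^sup>2 / 3) * (8 / 3 - 6 * Q)) * (1 - 9 / 4 * u) \<le> 9 / 8 * s" .
    qed (use u_bounds s in auto)
  next
    case False
    hence eQ: "4 / 3 * Q \<le> e" and Qs: "Q \<le> 49 / 10000" using large by auto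
    \<comment> \<open>This is \<open>4 / 3 * Q * (1 - 3 * Q)^2\<close>, a guaranteed part of the
      drop of \<open>c 1\<close> below \<open>g0\<close>, written as a multiple of
      \<open>u\<close>.\<close>
    define d where "d = 4 / 27 * u"
    have d: "0 \<le> d" "d \<le> 4 / 3 * Q" using u_bounds by (auto simp: d_def)
    have "d \<le> (1 - 3 * Q)\<^sup>2 * e"
      using mult_left_mono[OF eQ, of "(1 - 3 * Q)\<^sup>2"] by (simp add: d_def u_eq mult_ac)
    hence X: "(c 1)\<^sup>2 \<le> (g0 - d)\<^sup>2" using d c1_sq_le by blast
    show ?thesis
    \<comment> \<open>To first order the drop \<open>d\<close> adds \<open>2 * d\<close>, so 80/27 =
      8/3 + 8/27; the \<open>10 * Q\<close> covers all corrections.\<close>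
    proof (rule crude_estimate[where \<tau> = "80 / 27 - 10 * Q"])
      have "d * (2 - 76 / 3 * Q) \<le> d * (2 * g0 - d)"
        using d g0_ge by (intro mult_left_mono) auto
      hence "4 / 27 * u * (2 - 76 / 3 * Q) \<le> g0\<^sup>2 - (g0 - d)\<^sup>2"
        by (simp add: d_def power2_eq_square algebra_simps)
      moreover have "Q * u \<ge> 0" using u_bounds by simp
      ultimately show "(80 / 27 - 10 * Q) * u \<le> 1 - (c 1)\<^sup>2"
        using deficit X by (simp add: algebra_simps)
      have "Q * Q \<le> 49 / 10000 * Q" using Qs Q by (intro mult_right_mono) auto
      hence v2: "1 - 9 / 4 * u \<le> 1 - 19 * Q" using v(2) Q by simp
      have "1 - s\<^sup>2 / 3 - w * (80 / 27 - 10 * Q) = (1 - s\<^sup>2 / 3 - 80 / 27 * w) + 10 * (w * Q)"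
        by (simp add: algebra_simps)
      moreover have "1 - s\<^sup>2 / 3 - 80 / 27 * w \<le> 4825 / 10000" unfolding s(1) w_eq using s(3) by (simp add: field_simps)
      moreover have "10 * (w * Q) \<le> 154 / 100 * Q" using wQ by simp
      ultimately have "1 - s\<^sup>2 / 3 - (s / 2 - s\<^sup>2 / 3) * (80 / 27 - 10 * Q) \<le> 4825 / 10000 + 154 / 100 * Q"
        unfolding w_def[symmetric] by linarith
      hence "(1 - s\<^sup>2 / 3 - (s / 2 - s\<^sup>2 / 3) * (80 / 27 - 10 * Q)) * (1 - 9 / 4 * u)
             \<le> (4825 / 10000 + 154 / 100 * Q) * (1 - 19 * Q)"
        using v v2 Q by (intro mult_mono) auto
      also have "\<dots> = 4825 / 10000 - 76275 / 10000 * Q - 2926 / 100 * (Q * Q)"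
        by (simp add: field_simps)
      also have "\<dots> \<le> 9 / 8 * s" using Q QQ s(2) by linarith
      finally show "(1 - s\<^sup>2 / 3 - (s / 2 - s\<^sup>2 / 3) * (80 / 27 - 10 * Q)) * (1 - 9 / 4 * u) \<le> 9 / 8 * s" .
    qed (use u_bounds s in auto)
  qed
qed

text \<open>Near the extremal function nothing is lost at order \<open>Q\<close>, so
  \<open>c 2\<close> and the tail need their own bounds. The errors linear in \<open>e\<close> are
  paid for by the drop of \<open>c 1\<close>, those of order \<open>Q * Q\<close> by the quadratic
  term of the expansion of \<open>(s / 2) / (1 - 9 / 4 * u)\<close>.\<close>

lemma critical_refined:
  assumes s: "s\<^sup>2 = (59 * s - 24) / 8" "432 / 1000 \<le> s" "s \<le> 4321 / 10000"
    and small: "q \<le> 7 / 100" "e \<le> 4 / 3 * Q"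
  shows "(1 - 9 / 4 * u) * (u + s / 2 * (c 1)\<^sup>2 + s\<^sup>2 / 3 * (c 2)\<^sup>2 + (19 / 2 * e + 3 * Q)\<^sup>2 / 4) \<le> s / 2"
proof -
  have Qs: "Q \<le> 49 / 10000" using power_mono[OF small(1) q(1), of 2] by (simp add: power_divide Q_def)
  have ee: "e * e \<le> 4 / 3 * (Q * e)" using mult_right_mono[OF small(2) e] by simp
  have eQ: "Q * e \<le> 49 / 10000 * e" "Q * e \<le> 4 / 3 * (Q * Q)" "0 \<le> Q * e"
    using mult_right_mono[OF Qs e] mult_left_mono[OF small(2) Q(1)] mult_nonneg_nonneg[OF Q(1) e]
    by (simp_all add: mult_ac)
  define h where "h = (1 - 3 * Q)\<^sup>2 * e"
  have "(97 / 100 :: real) \<le> (9853 / 10000)\<^sup>2" by (simp add: power_divide)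
  also have "\<dots> \<le> (1 - 3 * Q)\<^sup>2" using Qs by (intro power_mono) auto
  finally have K: "97 / 100 \<le> (1 - 3 * Q)\<^sup>2" "(1 - 3 * Q)\<^sup>2 \<le> 1"
    using Qs Q by (auto intro!: power_le_one)
  have h: "97 / 100 * e \<le> h" "h \<le> e"
    using mult_right_mono[OF K(1) e] mult_right_mono[OF K(2) e] by (auto simp: h_def)
  \<comment> \<open>This is the gain in \<open>(c 1)^2\<close>; 187/100 bounds
    \<open>2 * g0 - h\<close> from below.\<close>
  have "97 / 100 * e * (187 / 100) \<le> h * (2 * g0 - h)"
    using h e g0_ge Qs small by (intro mult_mono) auto
  moreover have "(c 1)\<^sup>2 = g0\<^sup>2 - h * (2 * g0 - h)"
    unfolding c1_eq h_def[symmetric] by (simp add: power2_eq_square algebra_simps)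
  ultimately have "(c 1)\<^sup>2 \<le> 1 - (8 / 3 - 6 * Q) * u - 181 / 100 * e"
    using deficit e by linarith
  hence X: "s / 2 * (c 1)\<^sup>2 \<le> s / 2 * (1 - (8 / 3 - 6 * Q) * u - 181 / 100 * e)"
    using s by (intro mult_left_mono) auto
  have c0b: "0 \<le> c 0" "c 0 \<le> 21 / 100"
    using mult_mono[of "3 * q" "21 / 100" "1 - 3 * Q" 1] q small Q c_nonneg[of 0] by (auto simp: c0 Q_def)
  have "c 2 \<le> c 0 * (1 - 6 * Q) + 94 / 10 * e" using c2 small by (simp add: c0 Q_def)
  also have "c 0 * (1 - 6 * Q) \<le> c 0 * 1" using c0b Q by (intro mult_left_mono) auto
  finally have "(c 2)\<^sup>2 \<le> (c 0 + 94 / 10 * e)\<^sup>2" using c_nonneg[of 2] by (intro power_mono) auto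
  also have "\<dots> = u + 94 / 5 * (c 0 * e) + 8836 / 100 * (e * e)"
    by (simp add: u_def power2_eq_square algebra_simps)
  also have "\<dots> \<le> u + (395 / 100 * e + 118 * (Q * e))"
    using ee mult_right_mono[OF c0b(2) e] e eQ(3) by linarith
  finally have "s\<^sup>2 / 3 * (c 2)\<^sup>2 \<le> s\<^sup>2 / 3 * (u + (395 / 100 * e + 118 * (Q * e)))"
    using s by (intro mult_left_mono) auto
  also have "\<dots> = s\<^sup>2 / 3 * u + s\<^sup>2 / 3 * (395 / 100 * e + 118 * (Q * e))" by (simp add: algebra_simps)
  also have "s\<^sup>2 / 3 * (395 / 100 * e + 118 * (Q * e)) \<le> 6226 / 100000 * (395 / 100 * e + 118 * (Q * e))"
    using s e eQ by (intro mult_right_mono) auto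
  finally have Y: "s\<^sup>2 / 3 * (c 2)\<^sup>2 \<le> s\<^sup>2 / 3 * u + 6226 / 100000 * (395 / 100 * e + 118 * (Q * e))" by simp
  have "(19 / 2 * e + 3 * Q)\<^sup>2 = 361 / 4 * (e * e) + 57 * (Q * e) + 9 * (Q * Q)"
    by (simp add: power2_eq_square algebra_simps)
  hence T: "(19 / 2 * e + 3 * Q)\<^sup>2 / 4 \<le> 4435 / 100 * (Q * e) + 9 / 4 * (Q * Q)"
    using ee eQ by linarith
  have "s / 2 * (6 * Q * u) \<le> 4321 / 20000 * (6 * Q * (9 * Q))"
    using s Q u_bounds by (intro mult_mono) auto
  moreover have "s / 2 * (6 * Q * u) = 3 * s * (Q * u)" "4321 / 20000 * (6 * Q * (9 * Q)) = 116667 / 10000 * (Q * Q)"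
    by simp_all
  ultimately have sQu: "3 * s * (Q * u) \<le> 1167 / 100 * (Q * Q)" using zero_le_square[of Q] by linarith
  have "9 * Q * (97 / 100) \<le> u" using u_bounds(4) mult_left_mono[of "97/100" "1 - 6 * Q" "9 * Q"] Qs Q by simp
  hence "(9 * Q * (97 / 100)) * (9 * Q * (97 / 100)) \<le> u * u" using Q by (intro mult_mono) auto
  moreover have "(9 * Q * (97 / 100)) * (9 * Q * (97 / 100)) = 762129 / 10000 * (Q * Q)" by simp
  ultimately have "76 * (Q * Q) \<le> u * u" using zero_le_square[of Q] by linarith
  from mult_mono[OF s(2) this] have "432 / 1000 * (76 * (Q * Q)) \<le> s * (u * u)" using s by simp
  hence uu: "83 * (Q * Q) \<le> 81 / 32 * (s * (u * u))" using zero_le_square[of Q] by linarith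
  have se: "432 / 1000 * e \<le> s * e" using s e by (intro mult_right_mono) auto
  \<comment> \<open>The mixed product \<open>Q * e\<close> is charged partly to \<open>e\<close>,
    through \<open>Q \<le> 49 / 10000\<close>, and partly to \<open>Q * Q\<close>, through
    \<open>e \<le> 4 / 3 * Q\<close>.\<close>
  have eterms: "6226 / 100000 * (395 / 100 * e + 118 * (Q * e)) + 4435 / 100 * (Q * e) \<le> 181 / 200 * (s * e) + 30 * (Q * Q)"
  proof -
    have "6226 / 100000 * (395 / 100 * e + 118 * (Q * e)) = 245927 / 1000000 * e + 734668 / 100000 * (Q * e)"
      by (simp add: field_simps)
    thus ?thesis using se eQ zero_le_square[of Q] by linarith
  qed
  \<comment> \<open>Criticality enters here: \<open>1 - 4 / 3 * s + s^2 / 3 = 9 / 8 * s\<close> is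
    the equation \<open>8 s^2 - 59 s + 24 = 0\<close>, and 9/8 is exactly what the factor
    \<open>1 - 9 / 4 * u\<close> cancels below.\<close>
  have "u + s / 2 * (1 - (8 / 3 - 6 * Q) * u - 181 / 100 * e) + s\<^sup>2 / 3 * u =
        s / 2 + 9 / 8 * s * u + 3 * s * (Q * u) - 181 / 200 * (s * e)"
    unfolding s(1) by (simp add: field_simps)
  hence "u + s / 2 * (c 1)\<^sup>2 + s\<^sup>2 / 3 * (c 2)\<^sup>2 + (19 / 2 * e + 3 * Q)\<^sup>2 / 4
      \<le> s / 2 + 9 / 8 * s * u + 3 * s * (Q * u) - 181 / 200 * (s * e)
        + (6226 / 100000 * (395 / 100 * e + 118 * (Q * e)) + 4435 / 100 * (Q * e)) + 9 / 4 * (Q * Q)"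
    using X Y T by linarith
  \<comment> \<open>The costs 30, 1167/100 and 9/4 in units of \<open>Q * Q\<close> stay below the
    available 83. The right side is the geometric series of \<open>(s / 2) / (1 - 9 / 4 * u)\<close>
    cut after \<open>u * u\<close>.\<close>
  also have "\<dots> \<le> s / 2 + 9 / 8 * s * u + 81 / 32 * (s * (u * u))"
    using eterms sQu uu zero_le_square[of Q] by linarith
  finally have "u + s / 2 * (c 1)\<^sup>2 + s\<^sup>2 / 3 * (c 2)\<^sup>2 + (19 / 2 * e + 3 * Q)\<^sup>2 / 4
        \<le> s / 2 + 9 / 8 * s * u + 81 / 32 * (s * (u * u))" .
  hence "(1 - 9 / 4 * u) * (u + s / 2 * (c 1)\<^sup>2 + s\<^sup>2 / 3 * (c 2)\<^sup>2 + (19 / 2 * e + 3 * Q)\<^sup>2 / 4)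
        \<le> (1 - 9 / 4 * u) * (s / 2 + 9 / 8 * s * u + 81 / 32 * (s * (u * u)))"
    using u_bounds by (intro mult_left_mono) auto
  also have "\<dots> = s / 2 - 9 / 8 * s * u * (81 / 16 * (u * u))" by (simp add: field_simps)
  also have "\<dots> \<le> s / 2" using s u_bounds by simp
  finally show ?thesis .
qed

lemma partial_sum_at_critical:
  assumes s: "s\<^sup>2 = (59 * s - 24) / 8" "432 / 1000 \<le> s" "s \<le> 4321 / 10000"
  shows "(1 - 9 / 4 * u) * (\<Sum>k<N. (c k)\<^sup>2 * s ^ k / real (Suc k)) \<le> s / 2"
proof (cases "q \<le> 7 / 100 \<and> e \<le> 4 / 3 * Q")
  case True
  have "(1 - 9 / 4 * u) * (\<Sum>k<N. (c k)\<^sup>2 * s ^ k / real (Suc k)) \<le> (1 - 9 / 4 * u) *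
      (u + s / 2 * (c 1)\<^sup>2 + s\<^sup>2 / 3 * (c 2)\<^sup>2 + (19 / 2 * e + 3 * Q)\<^sup>2 / 4)"
    using sum_le_first_three[of c "4 / 9" _ s N, OF tail] True s(2,3) u_bounds(2)
    unfolding u_def Q_def by (intro mult_left_mono) auto
  also have "\<dots> \<le> s / 2" using True s by (intro critical_refined) auto
  finally show ?thesis .
next
  case False
  have "49 / 10000 \<le> Q \<or> 4 / 3 * Q \<le> e"
    using False power_mono[of "7 / 100" q 2] by (auto simp: power_divide Q_def)
  note crude = critical_crude[OF s this]
  have "(1 - 9 / 4 * u) * (\<Sum>k<N. (c k)\<^sup>2 * s ^ k / real (Suc k)) \<le> (1 - 9 / 4 * u) *
      (u + s / 2 * (c 1)\<^sup>2 + s\<^sup>2 / 3 * (1 - u - (c 1)\<^sup>2))"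
    using sum_le_first_two[of c s N, OF sum_le] s(2,3) u_bounds(2)
    unfolding u_def by (intro mult_left_mono) auto
  thus ?thesis using crude by linarith
qed

text \<open>The left side is convex in \<open>s\<close> and the right side linear, so the endpoints
  \<open>s0\<close> and 1 decide.\<close>

lemma partial_sum_le:
  assumes s0: "s0\<^sup>2 = (59 * s0 - 24) / 8" "432 / 1000 \<le> s0" "s0 \<le> 4321 / 10000"
    and s: "s0 \<le> s" "s \<le> 1"
  shows "(1 - 9 / 4 * u) * (\<Sum>k<N. (c k)\<^sup>2 * s ^ k / real (Suc k)) \<le> s / 2"
proof -
  define b where "b = (s - s0) / (1 - s0)"
  have b: "0 \<le> b" "b \<le> 1" and sb: "s = (1 - b) * s0 + b"
    using s s0 by (auto simp: b_def divide_simps) (simp add: algebra_simps)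
  have "(\<Sum>k<N. (c k)\<^sup>2 * s ^ k / real (Suc k)) \<le>
        (\<Sum>k<N. (c k)\<^sup>2 * ((1 - b) * s0 ^ k + b) / real (Suc k))"
    unfolding sb using s0 b
    by (intro sum_mono divide_right_mono mult_left_mono convex_combination_power_le) auto
  also have "\<dots> = (1 - b) * (\<Sum>k<N. (c k)\<^sup>2 * s0 ^ k / real (Suc k))
        + b * (\<Sum>k<N. (c k)\<^sup>2 * 1 ^ k / real (Suc k))"
    unfolding sum_distrib_left sum.distrib[symmetric] by (intro sum.cong refl) (simp add: algebra_simps add_divide_distrib diff_divide_distrib)
  finally have "(1 - 9 / 4 * u) * (\<Sum>k<N. (c k)\<^sup>2 * s ^ k / real (Suc k)) \<le> (1 - 9 / 4 * u) *
       ((1 - b) * (\<Sum>k<N. (c k)\<^sup>2 * s0 ^ k / real (Suc k))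
        + b * (\<Sum>k<N. (c k)\<^sup>2 * 1 ^ k / real (Suc k)))"
    using u_bounds by (intro mult_left_mono) auto
  also have "\<dots> = (1 - b) * ((1 - 9 / 4 * u) * (\<Sum>k<N. (c k)\<^sup>2 * s0 ^ k / real (Suc k)))
      + b * ((1 - 9 / 4 * u) * (\<Sum>k<N. (c k)\<^sup>2 * 1 ^ k / real (Suc k)))"
    by (simp only: distrib_left mult_ac)
  also have "\<dots> \<le> (1 - b) * (s0 / 2) + b * (1 / 2)"
    using b partial_sum_at_critical[OF s0, of N] partial_sum_at_one[of N]
    by (intro add_mono mult_left_mono) auto
  also have "\<dots> = s / 2" unfolding sb by (simp add: field_simps)
  finally show ?thesis .
qed

end

section \<open>Comparison with the Moebius translate\<close>

text \<open>For \<open>Z = v (1 - 9q^2) / (1 - 3q^2 - 2qv)\<close> the left side is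
  \<open>(3 - |Z|^2) |1 - 3q^2 - 2qv|^2\<close>. When \<open>|v| < 1\<close> and
  \<open>q^2 < 1 / 9\<close> the last summand is positive, so the Bloch bound on \<open>g\<close>
  becomes a bound by 1 for the transported function.\<close>

lemma moebius_norm_identity:
  fixes v :: complex and q :: real
  shows "3 * (norm (1 - 3 * of_real q ^ 2 - 2 * of_real q * v))\<^sup>2 - (norm v)\<^sup>2 * (1 - 9 * q\<^sup>2)\<^sup>2 =
    2 * (1 - 3 * q\<^sup>2) * (norm (1 - 3 * of_real q * v))\<^sup>2 + (1 - (norm v)\<^sup>2) * ((1 - 3 * q\<^sup>2) * (1 - 9 * q\<^sup>2))"
proof -
  obtain x y where v: "v = Complex x y" by (cases v)
  have 1: "1 - 3 * of_real q ^ 2 - 2 * of_real q * v = Complex (1 - 3 * q\<^sup>2 - 2 * q * x) (- 2 * q * y)"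
    by (simp add: v complex_eq_iff power2_eq_square)
  have 2: "1 - 3 * of_real q * v = Complex (1 - 3 * q * x) (- 3 * q * y)"
    by (simp add: v complex_eq_iff)
  show ?thesis unfolding 1 2 unfolding v cmod_power2 complex.sel by algebra
qed

lemma disc_automorphism_norm_less_1:
  fixes w :: complex and p :: real
  assumes "norm w < 1" "\<bar>p\<bar> < 1"
  shows "norm ((w + of_real p) / (1 + of_real p * w)) < 1"
proof -
  have "(norm (1 + of_real p * w))\<^sup>2 - (norm (w + of_real p))\<^sup>2 = (1 - p\<^sup>2) * (1 - (norm w)\<^sup>2)"
    unfolding cmod_power2 by (simp add: power2_eq_square algebra_simps)
  moreover have "(1 - p\<^sup>2) * (1 - (norm w)\<^sup>2) > 0"
    using assms by (intro mult_pos_pos) (auto simp: power_less_one_iff abs_square_less_1)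
  ultimately have "(norm (w + of_real p))\<^sup>2 < (norm (1 + of_real p * w))\<^sup>2" by linarith
  hence "norm (w + of_real p) < norm (1 + of_real p * w)" by (rule power2_less_imp_less) simp
  thus ?thesis by (simp add: norm_divide divide_less_eq_1)
qed

text \<open>The Bloch condition in the variable \<open>Z = sqrt 3 * z\<close>, scaled so that the
  bound is 1 on the unit circle. Rotations make \<open>g 0\<close> and the derivative real with the
  signs of a competitor vanishing at \<open>3q\<close>.\<close>

locale normalized_bloch =
  fixes g :: "complex \<Rightarrow> complex" and q y :: real
  assumes hol: "g holomorphic_on ball 0 (sqrt 3)"
    and bound: "norm Z < sqrt 3 \<Longrightarrow> norm (g Z) * (3 - (norm Z)\<^sup>2) \<le> 2"
    and q: "0 \<le> q" "q < 1 / 3"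
    and g0: "g 0 = - of_real (3 * q * (1 - 3 * q\<^sup>2))"
    and g1: "deriv g 0 = of_real y" and y: "0 \<le> y"
begin

definition K :: real where "K = 1 - 3 * q\<^sup>2"
text \<open>The defect: \<open>1 - e\<close> is the derivative at \<open>0\<close> of the normalised self-map of the disc.\<close>

definition e :: real where "e = 1 - (y + 6 * q\<^sup>2 * K) / K\<^sup>2"

lemma q2: "q\<^sup>2 < 1 / 9" "0 \<le> q\<^sup>2"
  using q power_strict_mono[of q "1/3" 2] by (auto simp: power_divide)

lemma K: "2 / 3 < K" "K \<le> 1"
  using q2 by (auto simp: K_def)

text \<open>In the coordinate \<open>(Z - 3q) / (1 - qZ)\<close> the transported derivative
  \<open>g(Z) (1 - qZ)^2 / K\<close> is bounded by 1, and for the competitor it is the identity.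
  Both coordinate and function equal \<open>-3q\<close> at \<open>Z = 0\<close>; one automorphism
  moves this value to 0 in each, giving \<open>v\<close> and \<open>chi\<close>. Then
  \<open>h = chi / v\<close> is a Schur function by the Schwarz lemma, with \<open>h = 1\<close> for
  the competitor.\<close>

lemma schur_function:
  obtains h where "h holomorphic_on ball 0 1" "\<And>v. norm v < 1 \<Longrightarrow> norm (h v) \<le> 1"
    "h 0 = of_real (1 - e)"
    "\<And>Z v. \<lbrakk>norm v < 1; v * (1 - 9 * of_real q ^ 2 + 2 * of_real q * Z) = of_real K * Z\<rbrakk> \<Longrightarrow>
       g Z = of_real K / (1 - of_real q * Z)\<^sup>2 *
         ((v * h v - 3 * of_real q) / (1 - 3 * of_real q * (v * h v)))"
proof -
  define a where "a = complex_of_real q"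
  define k where "k = complex_of_real K"
  have k0: "k \<noteq> 0" using K by (simp add: k_def)
  have "k = 1 - 3 * a\<^sup>2" by (simp add: k_def K_def a_def)
  note k = this k0
  have a9: "1 - 9 * a\<^sup>2 = of_real (1 - 9 * q\<^sup>2)" by (simp add: a_def)
  have na9: "1 - 9 * a\<^sup>2 \<noteq> 0" unfolding a9 using q2 by (simp only: of_real_eq_0_iff)
  have D0: "k - 2 * a * v \<noteq> 0" if "norm v < 1" for v
  proof
    assume "k - 2 * a * v = 0"
    hence "norm k = norm (2 * a * v)" by simp
    also have "\<dots> = 2 * q * norm v" using q by (simp add: a_def norm_mult)
    also have "\<dots> \<le> 2 * q * 1" using that q by (intro mult_left_mono) auto
    finally show False using q K by (simp add: k_def)
  qed
  have v0: "1 - 3 * a * v \<noteq> 0" if "norm v < 1" for v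
  proof
    assume "1 - 3 * a * v = 0"
    hence "norm (3 * a * v) = 1" by simp
    hence "3 * q * norm v = 1" using q by (simp add: a_def norm_mult)
    moreover have "3 * q * norm v \<le> 3 * q * 1" using that q by (intro mult_left_mono) auto
    ultimately show False using q by simp
  qed
  \<comment> \<open>\<open>Zf\<close> expresses \<open>Z\<close> through \<open>v\<close>,
    \<open>Om\<close> is the transported derivative in terms of \<open>v\<close>, and
    \<open>chi\<close> sends \<open>Om 0 = -3q\<close> to 0.\<close>
  define Zf where "Zf v = v * (1 - 9 * a\<^sup>2) / (k - 2 * a * v)" for v
  define Om where "Om v = g (Zf v) * (k * ((1 - 3 * a * v) / (k - 2 * a * v))\<^sup>2)" for v
  define chi where "chi v = (Om v + of_real (3 * q)) / (1 + of_real (3 * q) * Om v)" for v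
  have key: "2 * (K * (norm (1 - 3 * a * v))\<^sup>2) < (3 - (norm (Zf v))\<^sup>2) * (norm (k - 2 * a * v))\<^sup>2"
    if v: "norm v < 1" for v
  proof -
    have "(norm (Zf v))\<^sup>2 * (norm (k - 2 * a * v))\<^sup>2 = (norm (v * (1 - 9 * a\<^sup>2)))\<^sup>2"
      using D0[OF v] by (simp add: Zf_def norm_divide power_divide)
    also have "\<dots> = (norm v)\<^sup>2 * (1 - 9 * q\<^sup>2)\<^sup>2"
      unfolding a9 norm_mult norm_of_real by (simp add: power_mult_distrib)
    finally have "(3 - (norm (Zf v))\<^sup>2) * (norm (k - 2 * a * v))\<^sup>2 =
       2 * K * (norm (1 - 3 * a * v))\<^sup>2 + (1 - (norm v)\<^sup>2) * (K * (1 - 9 * q\<^sup>2))"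
      using moebius_norm_identity[of q v] unfolding k a_def K_def by (simp add: algebra_simps)
    moreover have "(1 - (norm v)\<^sup>2) * (K * (1 - 9 * q\<^sup>2)) > 0"
      using v K q2 by (intro mult_pos_pos) (auto simp: power_less_one_iff abs_square_less_1)
    ultimately show ?thesis by simp
  qed
  have Zb: "norm (Zf v) < sqrt 3" if v: "norm v < 1" for v
  proof -
    have "0 \<le> 2 * (K * (norm (1 - 3 * a * v))\<^sup>2)" using K by simp
    with key[OF v] have "0 < (3 - (norm (Zf v))\<^sup>2) * (norm (k - 2 * a * v))\<^sup>2" by linarith
    hence "(norm (Zf v))\<^sup>2 < 3" by (simp add: zero_less_mult_iff)
    thus ?thesis using real_less_rsqrt by blast
  qed
  have Om1: "norm (Om v) < 1" if v: "norm v < 1" for v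
  proof -
    define B where "B = K * (norm (1 - 3 * a * v))\<^sup>2"
    define A where "A = (3 - (norm (Zf v))\<^sup>2) * (norm (k - 2 * a * v))\<^sup>2"
    have B: "0 \<le> B" using K by (simp add: B_def)
    have AB: "2 * B < A" using key[OF v] by (simp add: A_def B_def)
    have n2: "(norm (k - 2 * a * v))\<^sup>2 > 0" using D0[OF v] by simp
    have "norm (Om v) * (norm (k - 2 * a * v))\<^sup>2 = norm (g (Zf v)) * B"
      using D0[OF v] K by (simp add: Om_def B_def norm_mult norm_divide norm_power power_divide k_def)
    hence "norm (Om v) * (norm (k - 2 * a * v))\<^sup>2 * A = B * (norm (g (Zf v)) * A)" by simp
    also have "norm (g (Zf v)) * A \<le> 2 * (norm (k - 2 * a * v))\<^sup>2"
      using mult_right_mono[OF bound[OF Zb[OF v]], of "(norm (k - 2 * a * v))\<^sup>2"] by (simp add: A_def mult_ac)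
    hence "B * (norm (g (Zf v)) * A) \<le> B * (2 * (norm (k - 2 * a * v))\<^sup>2)" using B by (rule mult_left_mono)
    finally have "(norm (Om v) * A) * (norm (k - 2 * a * v))\<^sup>2 \<le> (2 * B) * (norm (k - 2 * a * v))\<^sup>2"
      by (simp add: mult_ac)
    hence "norm (Om v) * A \<le> 2 * B" using n2 by (simp only: mult_le_cancel_right_pos)
    also have "\<dots> < 1 * A" using AB by simp
    finally show ?thesis using B AB mult_less_cancel_right_pos[of A "norm (Om v)" 1] by linarith
  qed
  have Zhol: "Zf holomorphic_on ball 0 1"
    unfolding Zf_def using D0 by (intro holomorphic_intros) auto
  have "(g \<circ> Zf) holomorphic_on ball 0 1"
    using Zb by (intro holomorphic_on_compose_gen[OF Zhol hol]) auto
  hence Omhol: "Om holomorphic_on ball 0 1"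
    unfolding Om_def o_def using D0 by (intro holomorphic_intros) auto
  have den: "1 + of_real (3 * q) * Om v \<noteq> 0" if v: "norm v < 1" for v
  proof
    assume "1 + of_real (3 * q) * Om v = 0"
    hence "of_real (3 * q) * Om v = -1" by (simp add: eq_neg_iff_add_eq_0 add.commute)
    hence "norm (of_real (3 * q) * Om v) = 1" by simp
    moreover have "norm (of_real (3 * q) * Om v) = 3 * q * norm (Om v)"
      using q by (simp only: norm_mult norm_of_real)
    moreover have "3 * q * norm (Om v) \<le> 3 * q * 1" using Om1[OF v] q by (intro mult_left_mono) auto
    ultimately show False using q by simp
  qed
  have chihol: "chi holomorphic_on ball 0 1"
    unfolding chi_def using den Omhol by (intro holomorphic_intros) auto
  have Om0: "Om 0 = - 3 * a"
    using k by (simp add: Om_def Zf_def g0 a_def power2_eq_square)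
  have chi0: "chi 0 = 0" by (simp add: chi_def Om0 a_def)
  have chi1: "norm (chi v) < 1" if "norm v < 1" for v
    unfolding chi_def using q by (intro disc_automorphism_norm_less_1 Om1 that) auto
  have gd: "(g has_field_derivative of_real y) (at 0)"
    using holomorphic_derivI[OF hol, of 0] g1 by simp
  have Zd: "(Zf has_field_derivative (1 - 9 * a\<^sup>2) / k) (at 0)"
    unfolding Zf_def using k by (auto intro!: derivative_eq_intros simp: field_simps power2_eq_square)
  have gZd: "((\<lambda>v. g (Zf v)) has_field_derivative of_real y * ((1 - 9 * a\<^sup>2) / k)) (at 0)"
    by (rule DERIV_chain2[OF _ Zd]) (simp add: Zf_def gd)
  have md: "((\<lambda>v. k * ((1 - 3 * a * v) / (k - 2 * a * v))\<^sup>2) has_field_derivative - 2 * a * (1 - 9 * a\<^sup>2) / k\<^sup>2) (at 0)"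
    using k(2) by (auto intro!: derivative_eq_intros simp: field_simps power2_eq_square) (simp add: k(1), algebra)
  have "(Om has_field_derivative of_real y * ((1 - 9 * a\<^sup>2) / k) * (1 / k) + - 2 * a * (1 - 9 * a\<^sup>2) / k\<^sup>2 * (- 3 * a * k)) (at 0)"
    unfolding Om_def using DERIV_mult[OF gZd md] k
    by (simp add: Zf_def g0 a_def power2_eq_square)
  \<comment> \<open>This evaluation dictates the formula for \<open>e\<close>; the factor
    \<open>1 - 9 * a^2\<close> disappears in the derivative of \<open>chi\<close>.\<close>
  also have "of_real y * ((1 - 9 * a\<^sup>2) / k) * (1 / k) + - 2 * a * (1 - 9 * a\<^sup>2) / k\<^sup>2 * (- 3 * a * k)
     = (1 - 9 * a\<^sup>2) * of_real (1 - e)"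
    using k(2) K by (simp add: e_def k_def a_def field_simps power2_eq_square)
  finally have Omd: "(Om has_field_derivative (1 - 9 * a\<^sup>2) * of_real (1 - e)) (at 0)" .
  define m where "m = (1 - 9 * a\<^sup>2) * of_real (1 - e)"
  have n0: "Om 0 + of_real (3 * q) = 0" and d0: "1 + of_real (3 * q) * Om 0 = 1 - 9 * a\<^sup>2"
    by (simp_all add: Om0 a_def power2_eq_square)
  have "((\<lambda>v. Om v + of_real (3 * q)) has_field_derivative m) (at 0)"
    and "((\<lambda>v. 1 + of_real (3 * q) * Om v) has_field_derivative of_real (3 * q) * m) (at 0)"
    using Omd unfolding m_def[symmetric] by (auto intro!: derivative_eq_intros)
  from DERIV_divide[OF this] have "(chi has_field_derivative of_real (1 - e)) (at 0)"
    unfolding chi_def[symmetric] n0 d0 using na9 by (simp add: m_def)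
  hence chid: "deriv chi 0 = of_real (1 - e)" by (rule DERIV_imp_deriv)
  obtain h where h: "h holomorphic_on ball 0 1" "\<And>v. norm v < 1 \<Longrightarrow> chi v = v * h v" "deriv chi 0 = h 0"
    using Schwarz3[OF chihol chi0] by blast
  have h1: "norm (h v) \<le> 1" if v: "norm v < 1" for v
  proof (cases "v = 0")
    case True
    then show ?thesis using Schwarz_Lemma(2)[OF chihol chi0 chi1 v] h(3) by simp
  next
    case False
    then show ?thesis using Schwarz_Lemma(1)[OF chihol chi0 chi1 v] h(2)[OF v] by (simp add: norm_mult)
  qed
  have gZ: "g Z = k / (1 - a * Z)\<^sup>2 * ((v * h v - 3 * a) / (1 - 3 * a * (v * h v)))"
    if v: "norm v < 1" and rel: "v * (1 - 9 * a\<^sup>2 + 2 * a * Z) = k * Z" for Z v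
  proof -
    have ZZ: "Zf v = Z" using rel D0[OF v] by (simp add: Zf_def field_simps)
    have D: "(k - 2 * a * v) * (1 - a * Z) = k * (1 - 3 * a * v)"
      using rel unfolding k(1) by algebra
    have qZ: "1 - a * Z \<noteq> 0" using D k(2) v0[OF v] by auto
    have "(1 - 3 * a * v) / (k - 2 * a * v) = (1 - a * Z) / k"
      using D D0[OF v] k(2) by (simp add: field_simps)
    hence "Om v = g Z * (1 - a * Z)\<^sup>2 / k"
      using k(2) by (simp add: Om_def ZZ power_divide power2_eq_square)
    hence gO: "g Z = k / (1 - a * Z)\<^sup>2 * Om v" using qZ k(2) by simp
    have dn: "1 + 3 * a * Om v \<noteq> 0" using den[OF v] by (simp add: a_def)
    have ch: "chi v * (1 + 3 * a * Om v) = Om v + 3 * a" using dn by (simp add: chi_def a_def)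
    hence ch': "Om v * (1 - 3 * a * chi v) = chi v - 3 * a" by (simp add: algebra_simps)
    have "1 - 3 * a * chi v \<noteq> 0"
    proof
      assume "1 - 3 * a * chi v = 0"
      hence "1 - 3 * a * (3 * a) = 0" using ch' by simp
      thus False using na9 by (simp add: power2_eq_square)
    qed
    hence "Om v = (chi v - 3 * a) / (1 - 3 * a * chi v)" using ch' by (simp add: field_simps)
    thus ?thesis using gO h(2)[OF v] by simp
  qed
  show thesis
    using that[of h] h(1) h1 h(3) chid gZ unfolding a_def k_def by metis
qed

lemma e_nonneg: "0 \<le> e"
proof -
  obtain h :: "complex \<Rightarrow> complex" where "\<And>v. norm v < 1 \<Longrightarrow> norm (h v) \<le> 1" "h 0 = of_real (1 - e)"
    by (rule schur_function) blast
  from this(1)[of 0] this(2) have "\<bar>1 - e\<bar> \<le> 1" by (metis norm_of_real norm_zero zero_less_one)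
  thus ?thesis by simp
qed

lemma y_eq: "y = K * (1 - 9 * q\<^sup>2) - K\<^sup>2 * e"
proof -
  have "K\<^sup>2 * e = K\<^sup>2 - (y + 6 * q\<^sup>2 * K)"
    using K by (simp add: e_def right_diff_distrib)
  thus ?thesis by (simp add: K_def power2_eq_square algebra_simps)
qed

text \<open>
  The competitor is split as its second Taylor polynomial plus \<open>Z^3\<close> times a cofactor, so that a bound on
  the deviation from it bounds the coefficient of \<open>Z^2\<close> without an \<open>O(q^2)\<close> error.
\<close>

definition quadratic_part :: "complex \<Rightarrow> complex" where
  "quadratic_part Z = of_real K * (- 3 * of_real q + (1 - 9 * of_real q ^ 2) * Z
     + (3 * of_real q - 18 * of_real q ^ 3) * Z ^ 2)"

definition cubic_cofactor :: "complex \<Rightarrow> complex" where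
  "cubic_cofactor Z = of_real K * (of_real q ^ 2 * (6 - 30 * of_real q ^ 2
     - of_real q * (8 - 45 * of_real q ^ 2) * Z + of_real q ^ 2 * (3 - 18 * of_real q ^ 2) * Z ^ 2))
     / (1 - of_real q * Z) ^ 3"

definition deviation :: "complex \<Rightarrow> complex" where
  "deviation Z = g Z - quadratic_part Z - Z ^ 3 * cubic_cofactor Z"

lemma one_minus_qZ_nonzero: "norm (Z :: complex) < 1 \<Longrightarrow> 1 - of_real q * Z \<noteq> 0"
proof
  assume Z: "norm Z < 1" and "1 - of_real q * Z = 0"
  hence "norm (of_real q * Z) = 1" by simp
  hence "q * norm Z = 1" using q by (simp add: norm_mult)
  moreover have "q * norm Z \<le> q * 1" using q Z by (intro mult_left_mono) auto
  ultimately show False using q by simp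
qed

lemma extremal_split:
  assumes "norm Z < 1"
  shows "quadratic_part Z + Z ^ 3 * cubic_cofactor Z
    = of_real K * (Z - 3 * of_real q) / (1 - of_real q * Z) ^ 3"
proof -
  define a where "a = complex_of_real q"
  have nz: "(1 - a * Z) ^ 3 \<noteq> 0" using one_minus_qZ_nonzero[OF assms] by (simp add: a_def)
  define P where "P = - 3 * a + (1 - 9 * a ^ 2) * Z + (3 * a - 18 * a ^ 3) * Z ^ 2"
  define N where "N = a ^ 2 * (6 - 30 * a ^ 2 - a * (8 - 45 * a ^ 2) * Z + a ^ 2 * (3 - 18 * a ^ 2) * Z ^ 2)"
  have "Z - 3 * a = P * (1 - a * Z) ^ 3 + Z ^ 3 * N" unfolding P_def N_def by algebra
  hence "of_real K * (Z - 3 * a) / (1 - a * Z) ^ 3 = of_real K * P + Z ^ 3 * (of_real K * N / (1 - a * Z) ^ 3)"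
    using nz by (simp add: distrib_left add_divide_distrib mult.left_commute)
  thus ?thesis
    unfolding quadratic_part_def cubic_cofactor_def P_def N_def by (simp add: a_def)
qed

text \<open>The numerator of the cofactor carries a factor \<open>q^2\<close>, so this term enters
  the squared tail only at order \<open>q^4\<close>.\<close>

lemma norm_cubic_term_le:
  assumes "q \<le> 7 / 100" "norm Z \<le> 2 / 3"
  shows "norm (Z ^ 3 * cubic_cofactor Z) \<le> 3 * q\<^sup>2"
proof -
  define a where "a = complex_of_real q"
  have na: "norm a = q" using q by (simp add: a_def)
  have Qs: "q\<^sup>2 \<le> 49 / 10000" using power_mono[OF assms(1) q(1), of 2] by (simp add: power_divide)
  have r: "norm (of_real x - of_real z * a ^ 2) \<le> x" if "0 \<le> z" "z * (49 / 10000) \<le> x" for x z :: real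
  proof -
    have "of_real x - of_real z * a ^ 2 = of_real (x - z * q\<^sup>2)" by (simp add: a_def)
    hence "norm (of_real x - of_real z * a ^ 2) = \<bar>x - z * q\<^sup>2\<bar>" by (simp only: norm_of_real)
    thus ?thesis using mult_left_mono[OF Qs that(1)] that by simp
  qed
  have r': "norm (6 - 30 * a ^ 2) \<le> 6" "norm (8 - 45 * a ^ 2) \<le> 8" "norm (3 - 18 * a ^ 2) \<le> 3"
    using r[of 30 6] r[of 45 8] r[of 18 3] by simp_all
  have "norm (6 - 30 * a ^ 2 - a * (8 - 45 * a ^ 2) * Z + a ^ 2 * (3 - 18 * a ^ 2) * Z ^ 2)
    \<le> norm (6 - 30 * a ^ 2) + norm (a * (8 - 45 * a ^ 2) * Z) + norm (a ^ 2 * (3 - 18 * a ^ 2) * Z ^ 2)"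
    by (meson add_right_mono norm_triangle_ineq norm_triangle_ineq4 order_trans)
  also have "\<dots> \<le> 6 + (7 / 100) * 8 * (2 / 3) + (7 / 100) ^ 2 * 3 * (2 / 3) ^ 2"
    unfolding norm_mult norm_power na using r' assms q by (intro add_mono mult_mono power_mono) auto
  also have "\<dots> \<le> 7" by (simp add: power_divide)
  finally have N: "norm (6 - 30 * a ^ 2 - a * (8 - 45 * a ^ 2) * Z + a ^ 2 * (3 - 18 * a ^ 2) * Z ^ 2) \<le> 7" .
  have "q * norm Z \<le> 7 / 100 * (2 / 3)" using assms q by (intro mult_mono) auto
  hence "95 / 100 \<le> norm (1 - a * Z)"
    using norm_triangle_ineq2[of 1 "a * Z"] by (simp add: norm_mult na)
  hence D: "(95 / 100) ^ 3 \<le> norm (1 - a * Z) ^ 3" by (intro power_mono) auto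
  have "norm (Z ^ 3 * cubic_cofactor Z) = norm Z ^ 3 * (K * (q\<^sup>2 * norm (6 - 30 * a ^ 2 - a * (8 - 45 * a ^ 2) * Z
      + a ^ 2 * (3 - 18 * a ^ 2) * Z ^ 2)) / norm (1 - a * Z) ^ 3)"
    unfolding cubic_cofactor_def a_def[symmetric] norm_mult norm_divide norm_power na using K by simp
  also have "\<dots> \<le> (2 / 3) ^ 3 * (1 * (q\<^sup>2 * 7) / (95 / 100) ^ 3)"
    using N D K assms q by (intro mult_mono frac_le power_mono mult_left_mono) auto
  also have "\<dots> \<le> 3 * q\<^sup>2" by (simp add: power_divide)
  finally show ?thesis .
qed

text \<open>In terms of \<open>v\<close> the competitor is the case \<open>h = 1\<close>, so the
  deviation compares one Moebius map at \<open>v * h v\<close> and at \<open>v\<close>, whose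
  distance is \<open>|v| |1 - h v|\<close>, linear in \<open>e\<close>. \<open>V\<close> bounds
  \<open>|v|\<close> for \<open>|Z| \<le> r\<close>; the decimals are 1 - 9 q^2, 2q, 3q and q
  evaluated at q = 7/100.\<close>

lemma norm_deviation_le:
  assumes q7: "q \<le> 7 / 100" and Z: "norm Z \<le> r" "r \<le> 2 / 3"
    and V: "r \<le> V * (9559 / 10000 - 14 / 100 * r)" "V < 1"
  shows "norm (deviation Z) \<le>
    1 / (1 - 7 / 100 * r)\<^sup>2 * (V * (1 + V) / (1 - V)) / (1 - 21 / 100 * V)\<^sup>2 * e"
proof -
  define a where "a = complex_of_real q"
  define k where "k = complex_of_real K"
  have k0: "k \<noteq> 0" using K by (simp add: k_def)
  have "k = 1 - 3 * a\<^sup>2" by (simp add: k_def K_def a_def)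
  note k = this k0
  have na: "norm a = q" using q by (simp add: a_def)
  have Qs: "q\<^sup>2 \<le> 49 / 10000" using power_mono[OF q7 q(1), of 2] by (simp add: power_divide)
  have r0: "0 \<le> r" using Z norm_ge_zero[of Z] by linarith
  have V0: "0 \<le> V"
  proof (rule ccontr)
    assume "\<not> 0 \<le> V"
    hence "V * (9559 / 10000 - 14 / 100 * r) < 0" using Z by (intro mult_neg_pos) auto
    thus False using V r0 by simp
  qed
  define B where "B = 1 - 9 * a\<^sup>2 + 2 * a * Z"
  have "norm (9 * a\<^sup>2 - 2 * a * Z) \<le> norm (9 * a\<^sup>2) + norm (2 * a * Z)" by (rule norm_triangle_ineq4)
  also have "\<dots> = 9 * q\<^sup>2 + 2 * q * norm Z" by (simp add: norm_mult norm_power na)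
  also have "\<dots> \<le> 9 * (49 / 10000) + 2 * (7 / 100) * r"
    using Qs q7 q Z by (intro add_mono mult_mono) auto
  finally have B: "9559 / 10000 - 14 / 100 * r \<le> norm B"
    using norm_triangle_ineq2[of 1 "9 * a\<^sup>2 - 2 * a * Z"] by (simp add: B_def algebra_simps)
  have Bpos: "0 < 9559 / 10000 - 14 / 100 * r" using Z by simp
  define v where "v = k * Z / B"
  have rel: "v * (1 - 9 * a\<^sup>2 + 2 * a * Z) = k * Z" using B Bpos by (auto simp: v_def B_def[symmetric])
  have "norm v * norm B = K * norm Z" using B Bpos K by (auto simp: v_def norm_divide norm_mult k_def)
  also have "\<dots> \<le> 1 * r" using K Z by (intro mult_mono) auto
  also have "1 * r \<le> V * (9559 / 10000 - 14 / 100 * r)" using V by simp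
  also have "\<dots> \<le> V * norm B" using B V0 by (intro mult_left_mono)
  finally have vV: "norm v \<le> V" using B Bpos mult_le_cancel_right_pos[of "norm B" "norm v" V] by linarith
  hence v1: "norm v < 1" using V by simp
  obtain h where h: "h holomorphic_on ball 0 1" "\<And>v. norm v < 1 \<Longrightarrow> norm (h v) \<le> 1" "h 0 = of_real (1 - e)"
    and gZ: "\<And>Z v. \<lbrakk>norm v < 1; v * (1 - 9 * of_real q ^ 2 + 2 * of_real q * Z) = of_real K * Z\<rbrakk> \<Longrightarrow>
       g Z = of_real K / (1 - of_real q * Z)\<^sup>2 *
         ((v * h v - 3 * of_real q) / (1 - 3 * of_real q * (v * h v)))"
    by (rule schur_function) blast
  define x where "x = v * h v"
  have gx: "g Z = k / (1 - a * Z)\<^sup>2 * ((x - 3 * a) / (1 - 3 * a * x))"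
    unfolding x_def k_def a_def by (rule gZ[OF v1]) (use rel in \<open>simp add: k_def a_def\<close>)
  have "norm (1 - h v) \<le> (1 - (1 - e)) * ((1 + norm v) / (1 - norm v))"
    by (rule norm_one_minus_le[OF h v1])
  also have "\<dots> \<le> e * ((1 + V) / (1 - V))"
    using vV V V0 e_nonneg by (auto intro!: mult_left_mono frac_le)
  finally have h1: "norm (1 - h v) \<le> e * ((1 + V) / (1 - V))" .
  have xv: "norm (x - v) \<le> V * (e * ((1 + V) / (1 - V)))"
  proof -
    have "x - v = - (v * (1 - h v))" by (simp add: x_def algebra_simps)
    hence "norm (x - v) = norm v * norm (1 - h v)" by (simp add: norm_mult)
    also have "\<dots> \<le> V * (e * ((1 + V) / (1 - V)))" using vV h1 V0 by (intro mult_mono) auto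
    finally show ?thesis .
  qed
  have "norm x \<le> norm v * 1" unfolding x_def norm_mult using h(2)[OF v1] by (intro mult_left_mono) auto
  hence xV: "norm x \<le> V" using vV by simp
  have den: "1 - 21 / 100 * V \<le> norm (1 - 3 * a * z)" if "norm z \<le> V" for z
  proof -
    have "3 * q * norm z \<le> 3 * (7 / 100) * V" using q q7 that by (intro mult_mono) auto
    thus ?thesis using norm_triangle_ineq2[of 1 "3 * a * z"] by (simp add: norm_mult na)
  qed
  have dpos: "0 < 1 - 21 / 100 * V" using V by simp
  have nx: "1 - 3 * a * x \<noteq> 0" and nv: "1 - 3 * a * v \<noteq> 0" using den[OF xV] den[OF vV] dpos by auto
  have Z1: "norm Z < 1" using Z by simp
  have nZ: "1 - a * Z \<noteq> 0" using one_minus_qZ_nonzero[OF Z1] by (simp add: a_def)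
  have "(v - 3 * a) * (1 - a * Z) = (Z - 3 * a) * (1 - 3 * a * v)"
    using rel unfolding k(1) by algebra
  hence ex: "(Z - 3 * a) / (1 - a * Z) = (v - 3 * a) / (1 - 3 * a * v)"
    using nZ nv by (simp add: field_simps)
  have "deviation Z = g Z - k * (Z - 3 * a) / (1 - a * Z) ^ 3"
    using extremal_split[OF Z1] by (simp add: deviation_def k_def a_def algebra_simps)
  also have "k * (Z - 3 * a) / (1 - a * Z) ^ 3 = k / (1 - a * Z)\<^sup>2 * ((Z - 3 * a) / (1 - a * Z))"
    by (simp add: power2_eq_square power3_eq_cube)
  finally have "deviation Z = k / (1 - a * Z)\<^sup>2 * ((x - 3 * a) / (1 - 3 * a * x) - (v - 3 * a) / (1 - 3 * a * v))"
    unfolding ex gx by (simp add: right_diff_distrib)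
  also have "(x - 3 * a) / (1 - 3 * a * x) - (v - 3 * a) / (1 - 3 * a * v)
      = (1 - 9 * a\<^sup>2) * (x - v) / ((1 - 3 * a * x) * (1 - 3 * a * v))"
    using nx nv by (simp add: divide_simps) algebra
  finally have dev: "deviation Z = k / (1 - a * Z)\<^sup>2 * ((1 - 9 * a\<^sup>2) * (x - v) / ((1 - 3 * a * x) * (1 - 3 * a * v)))" .
  have "q * norm Z \<le> 7 / 100 * r" using q q7 Z by (intro mult_mono) auto
  hence dZ: "1 - 7 / 100 * r \<le> norm (1 - a * Z)"
    using norm_triangle_ineq2[of 1 "a * Z"] by (simp add: norm_mult na)
  have a9: "norm (1 - 9 * a\<^sup>2) \<le> 1"
  proof -
    have "1 - 9 * a\<^sup>2 = of_real (1 - 9 * q\<^sup>2)" by (simp add: a_def)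
    hence "norm (1 - 9 * a\<^sup>2) = \<bar>1 - 9 * q\<^sup>2\<bar>" by (simp only: norm_of_real)
    thus ?thesis using q2 by simp
  qed
  have "norm (deviation Z) = K / (norm (1 - a * Z))\<^sup>2 * (norm (1 - 9 * a\<^sup>2) * norm (x - v) /
      (norm (1 - 3 * a * x) * norm (1 - 3 * a * v)))"
    unfolding dev norm_mult norm_divide norm_power k_def using K by simp
  also have "\<dots> \<le> 1 / (1 - 7 / 100 * r)\<^sup>2 * (1 * (V * (e * ((1 + V) / (1 - V)))) /
      ((1 - 21 / 100 * V) * (1 - 21 / 100 * V)))"
    using K Z dZ a9 xv den[OF xV] den[OF vV] dpos V V0 e_nonneg
    by (intro mult_mono frac_le power_mono mult_pos_pos) auto
  also have "\<dots> = 1 / (1 - 7 / 100 * r)\<^sup>2 * (V * (1 + V) / (1 - V)) / (1 - 21 / 100 * V)\<^sup>2 * e"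
    by (simp add: power2_eq_square mult_ac)
  finally show ?thesis .
qed

lemma deviation_le_two_thirds:
  assumes "q \<le> 7 / 100" "norm Z \<le> 2 / 3"
  shows "norm (deviation Z) \<le> 19 / 2 * e"
proof -
  have "norm (deviation Z) \<le> 1 / (1 - 7 / 100 * (2 / 3))\<^sup>2 * (773 / 1000 * (1 + 773 / 1000) / (1 - 773 / 1000)) /
      (1 - 21 / 100 * (773 / 1000))\<^sup>2 * e"
    using assms by (intro norm_deviation_le) auto
  also have "\<dots> \<le> 19 / 2 * e"
    using e_nonneg by (intro mult_right_mono) (auto simp: power2_eq_square)
  finally show ?thesis .
qed

lemma deviation_le_two_fifths:
  assumes "q \<le> 7 / 100" "norm Z \<le> 2 / 5"
  shows "norm (deviation Z) \<le> 94 / 10 * (2 / 5)\<^sup>2 * e"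
proof -
  have "norm (deviation Z) \<le> 1 / (1 - 7 / 100 * (2 / 5))\<^sup>2 * (4445 / 10000 * (1 + 4445 / 10000) / (1 - 4445 / 10000)) /
      (1 - 21 / 100 * (4445 / 10000))\<^sup>2 * e"
    using assms by (intro norm_deviation_le) auto
  also have "\<dots> \<le> 94 / 10 * (2 / 5)\<^sup>2 * e"
    using e_nonneg by (intro mult_right_mono) (auto simp: power2_eq_square)
  finally show ?thesis .
qed

section \<open>Bounds on the Taylor coefficients of \<open>g\<close>\<close>

lemma holomorphic_pieces:
  "cubic_cofactor holomorphic_on ball 0 1" "deviation holomorphic_on ball 0 1"
  "(\<lambda>Z. g Z - quadratic_part Z) holomorphic_on ball 0 1"
proof -
  have g: "g holomorphic_on ball 0 1" using hol by (rule holomorphic_on_subset) (simp add: subset_ball)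
  show c: "cubic_cofactor holomorphic_on ball 0 1"
    unfolding cubic_cofactor_def using one_minus_qZ_nonzero by (intro holomorphic_intros) auto
  show "deviation holomorphic_on ball 0 1" "(\<lambda>Z. g Z - quadratic_part Z) holomorphic_on ball 0 1"
    unfolding deviation_def quadratic_part_def using g c by (auto intro!: holomorphic_intros)
qed

lemma taylor_coeff_eqs:
  "taylor_coeff g 2 = of_real (3 * q * (1 - 3 * q\<^sup>2) * (1 - 6 * q\<^sup>2)) + taylor_coeff deviation 2"
  "taylor_coeff g (k + 3) = taylor_coeff (\<lambda>Z. g Z - quadratic_part Z) (k + 3)"
proof -
  have ex: "f has_fps_expansion fps_expansion f 0" if "f holomorphic_on ball 0 1" for f
    using that by (intro has_fps_expansion_fps_expansion[of "ball 0 1"]) auto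
  have nth: "fps_nth F n = taylor_coeff f n" if "f has_fps_expansion F" for f F n
    using fps_nth_fps_expansion[OF that] by (simp add: taylor_coeff_def)
  define P where "P = fps_const (of_real K) * (fps_const (- 3 * of_real q) + fps_const (1 - 9 * of_real q ^ 2) * fps_X
     + fps_const (3 * complex_of_real q - 18 * of_real q ^ 3) * fps_X ^ 2)"
  have P: "quadratic_part has_fps_expansion P"
    unfolding quadratic_part_def P_def by (intro fps_expansion_intros)
  have "(\<lambda>Z. deviation Z + quadratic_part Z + Z ^ 3 * cubic_cofactor Z) has_fps_expansion
     fps_expansion deviation 0 + P + fps_X ^ 3 * fps_expansion cubic_cofactor 0"
    by (intro fps_expansion_intros P ex holomorphic_pieces)
  hence "g has_fps_expansion fps_expansion deviation 0 + P + fps_X ^ 3 * fps_expansion cubic_cofactor 0"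
    by (simp add: deviation_def)
  from nth[OF this, of 2] nth[OF ex[OF holomorphic_pieces(2)], of 2]
  have "taylor_coeff g 2 = taylor_coeff deviation 2 + of_real K * (3 * of_real q - 18 * of_real q ^ 3)"
    by (simp add: P_def fps_X_power_mult_nth)
  also have "of_real K * (3 * of_real q - 18 * of_real q ^ 3) = complex_of_real (3 * q * (1 - 3 * q\<^sup>2) * (1 - 6 * q\<^sup>2))"
    by (simp add: K_def algebra_simps power2_eq_square power3_eq_cube)
  finally show "taylor_coeff g 2 = of_real (3 * q * (1 - 3 * q\<^sup>2) * (1 - 6 * q\<^sup>2)) + taylor_coeff deviation 2" by simp
  have "(\<lambda>Z. (g Z - quadratic_part Z) + quadratic_part Z) has_fps_expansion
     fps_expansion (\<lambda>Z. g Z - quadratic_part Z) 0 + P"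
    by (intro fps_expansion_intros P ex holomorphic_pieces)
  hence "g has_fps_expansion fps_expansion (\<lambda>Z. g Z - quadratic_part Z) 0 + P" by simp
  from nth[OF this, of "k + 3"] nth[OF ex[OF holomorphic_pieces(3)], of "k + 3"]
  show "taylor_coeff g (k + 3) = taylor_coeff (\<lambda>Z. g Z - quadratic_part Z) (k + 3)"
    by (simp add: P_def fps_X_power_mult_nth)
qed

text \<open>One term of Bessel's inequality for the deviation is a Cauchy estimate; the radius 2/5
  gives a smaller constant than 2/3 would.\<close>

lemma coefficient_2_le:
  assumes "q \<le> 7 / 100"
  shows "norm (taylor_coeff g 2) \<le> 3 * q * (1 - 3 * q\<^sup>2) * (1 - 6 * q\<^sup>2) + 94 / 10 * e"
proof -
  have "(norm (taylor_coeff deviation 2))\<^sup>2 * (2 / 5) ^ (2 * 2)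
      \<le> (\<Sum>k<3. (norm (taylor_coeff deviation k))\<^sup>2 * (2 / 5) ^ (2 * k))"
    by (rule member_le_sum) auto
  also have "\<dots> \<le> (94 / 10 * (2 / 5)\<^sup>2 * e)\<^sup>2"
    by (rule taylor_coeff_bessel[OF holomorphic_pieces(2)]) (use deviation_le_two_fifths assms in auto)
  finally have "(norm (taylor_coeff deviation 2) * (2 / 5)\<^sup>2)\<^sup>2 \<le> (94 / 10 * (2 / 5)\<^sup>2 * e)\<^sup>2"
    by (simp add: power_mult_distrib flip: power_mult)
  hence "norm (taylor_coeff deviation 2) * (2 / 5)\<^sup>2 \<le> 94 / 10 * (2 / 5)\<^sup>2 * e"
    by (rule power2_le_imp_le) (use e_nonneg in auto)
  hence d: "norm (taylor_coeff deviation 2) \<le> 94 / 10 * e" by simp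
  have "norm (complex_of_real (3 * q * (1 - 3 * q\<^sup>2) * (1 - 6 * q\<^sup>2))) = 3 * q * (1 - 3 * q\<^sup>2) * (1 - 6 * q\<^sup>2)"
    unfolding norm_of_real using q q2 by (intro abs_of_nonneg mult_nonneg_nonneg) auto
  with d show ?thesis
    unfolding taylor_coeff_eqs(1) by (intro order_trans[OF norm_triangle_ineq]) linarith
qed

lemma tail_le:
  assumes "q \<le> 7 / 100"
  shows "(\<Sum>k<n. (norm (taylor_coeff g (k + 3)))\<^sup>2 * (4 / 9) ^ (k + 3)) \<le> (19 / 2 * e + 3 * q\<^sup>2)\<^sup>2"
proof -
  define f where "f k = (norm (taylor_coeff (\<lambda>Z. g Z - quadratic_part Z) k))\<^sup>2 * (2 / 3 :: real) ^ (2 * k)" for k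
  have "(\<Sum>k<n. (norm (taylor_coeff g (k + 3)))\<^sup>2 * (4 / 9) ^ (k + 3)) = (\<Sum>k<n. f (k + 3))"
    unfolding f_def taylor_coeff_eqs(2) power_mult by (simp add: power_divide)
  also have "\<dots> = sum f ((\<lambda>k. k + 3) ` {..<n})" by (simp add: sum.reindex)
  also have "\<dots> \<le> sum f {..<n + 3}" by (rule sum_mono2) (auto simp: f_def)
  also have "\<dots> \<le> (19 / 2 * e + 3 * q\<^sup>2)\<^sup>2"
    unfolding f_def
  proof (rule taylor_coeff_bessel[OF holomorphic_pieces(3)])
    fix Z :: complex assume Z: "norm Z = 2 / 3"
    have "g Z - quadratic_part Z = deviation Z + Z ^ 3 * cubic_cofactor Z" by (simp add: deviation_def)
    also have "norm \<dots> \<le> 19 / 2 * e + 3 * q\<^sup>2"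
      using deviation_le_two_thirds[OF assms, of Z] norm_cubic_term_le[OF assms, of Z] Z
      by (intro order_trans[OF norm_triangle_ineq]) linarith
    finally show "norm (g Z - quadratic_part Z) \<le> 19 / 2 * e + 3 * q\<^sup>2" .
  qed auto
  finally show ?thesis .
qed

lemma sum_coefficients_le: "(\<Sum>k<n. (norm (taylor_coeff g k))\<^sup>2) \<le> 1"
proof -
  have "(\<Sum>k<n. (norm (taylor_coeff g k))\<^sup>2 * 1 ^ (2 * k)) \<le> 1\<^sup>2"
  proof (rule taylor_coeff_bessel[OF hol])
    fix Z :: complex assume "norm Z = 1"
    thus "norm (g Z) \<le> 1" using bound[of Z] by simp
  qed auto
  thus ?thesis by simp
qed

end

section \<open>Bloch functions\<close>

lemma exists_unimodular_rotation: "\<exists>c::complex. norm c = 1 \<and> c * w = of_real (norm w)"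
proof (cases "w = 0")
  case False
  have "cnj w * w = of_real (norm w) * of_real (norm w)"
    using complex_norm_square[of w] by (simp add: power2_eq_square mult.commute)
  with False show ?thesis
    by (intro exI[of _ "cnj w / of_real (norm w)"]) (simp add: norm_divide)
qed (auto intro: exI[of _ 1])

lemma taylor_coeff_Suc: "taylor_coeff F (Suc k) = taylor_coeff (deriv F) k / of_nat (Suc k)"
  by (simp add: taylor_coeff_def funpow_Suc_right algebra_simps del: funpow.simps)

lemma taylor_coeff_rescale:
  assumes "f holomorphic_on ball 0 1" and d: "d \<noteq> 0"
  shows "taylor_coeff (\<lambda>Z. b * f (d * Z)) k = b * d ^ k * taylor_coeff f k"
proof -
  let ?S = "ball 0 (1 / norm d)"
  have S: "d * w \<in> ball 0 1" if "w \<in> ?S" for w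
    using that d by (simp add: norm_mult field_simps)
  have h: "(\<lambda>Z. f (d * Z)) holomorphic_on ?S"
    using S by (intro holomorphic_on_compose_gen[OF _ assms(1), unfolded o_def] holomorphic_intros) auto
  have "(deriv ^^ k) (\<lambda>Z. b * f (d * Z)) 0 = b * (deriv ^^ k) (\<lambda>Z. f (d * Z)) 0"
    using d by (intro higher_deriv_cmult[OF h]) auto
  also have "(deriv ^^ k) (\<lambda>Z. f (d * Z)) 0 = d ^ k * (deriv ^^ k) f (d * 0)"
    using d S by (intro higher_deriv_compose_linear[OF assms(1), of ?S]) auto
  finally show ?thesis by (simp add: taylor_coeff_def)
qed

lemma bloch_sum_le:
  assumes F: "F \<in> bloch_class"
    and s0: "s0\<^sup>2 = (59 * s0 - 24) / 8" "432 / 1000 \<le> s0" "s0 \<le> 4321 / 10000"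
    and s: "s0 \<le> 3 * r\<^sup>2" "3 * r\<^sup>2 \<le> 1"
  shows "bloch_sum F r \<le> 27 / 8 * r ^ 4"
proof -
  define f where "f = deriv F"
  have fhol: "f holomorphic_on ball 0 1"
    unfolding f_def using F by (auto simp: bloch_class_def intro!: holomorphic_deriv)
  have fb: "norm (f z) \<le> 1 / (1 - (norm z)\<^sup>2)" if "norm z < 1" for z
    using F that by (auto simp: bloch_class_def f_def)
  define a where "a = norm (f 0)"
  have a: "0 \<le> a" "a \<le> 1" using fb[of 0] by (auto simp: a_def)
  have b1: "norm (taylor_coeff F 1) = a"
    by (simp add: taylor_coeff_def a_def f_def)
  show ?thesis
  proof (cases "a = 1")
    case True
    then show ?thesis using b1 by (simp add: bloch_sum_def)
  next
    case False
    hence a1: "a < 1" using a by simp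
    \<comment> \<open>\<open>3q(1 - 3q^2)\<close> runs from 0 to 2/3 on the interval from 0 to 1/3,
      and \<open>2 / 3 * a\<close> is \<open>|g 0|\<close>.\<close>
    have "\<exists>q\<ge>0. q \<le> 1 / 3 \<and> 3 * q * (1 - 3 * q\<^sup>2) = 2 / 3 * a"
      using a by (intro IVT') (auto intro!: continuous_intros simp: power2_eq_square)
    then obtain q where q: "0 \<le> q" "q \<le> 1 / 3" and qa: "3 * q * (1 - 3 * q\<^sup>2) = 2 / 3 * a" by blast
    have "q \<noteq> 1 / 3"
    proof
      assume "q = 1 / 3"
      with qa a1 show False by (simp add: power2_eq_square)
    qed
    hence q1: "q < 1 / 3" using q by simp
    obtain c0 where c0: "norm c0 = 1" "c0 * f 0 = of_real a"
      using exists_unimodular_rotation[of "f 0"] by (auto simp: a_def)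
    obtain c1 where c1: "norm c1 = 1" "c1 * (- c0 * deriv f 0) = of_real (norm (deriv f 0))"
      using exists_unimodular_rotation[of "- c0 * deriv f 0"] c0 by (auto simp: norm_mult)
    define b d where "b = - (2 / 3) * c0" and "d = c1 / of_real (sqrt 3)"
    have nb: "norm b = 2 / 3" and nd: "norm d = 1 / sqrt 3"
      using c0 c1 by (auto simp: b_def d_def norm_mult norm_divide)
    have d0: "d \<noteq> 0" using nd by auto
    define g where "g Z = b * f (d * Z)" for Z
    have tg: "taylor_coeff g k = b * d ^ k * taylor_coeff f k" for k
      unfolding g_def using taylor_coeff_rescale[OF fhol d0] by simp
    have dZ: "norm (d * Z) < 1" if "norm Z < sqrt 3" for Z
      using that by (simp add: norm_mult nd)
    define y where "y = 2 / 3 / sqrt 3 * norm (deriv f 0)"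
    have "deriv g 0 = b * d * deriv f 0"
      using tg[of 1] by (simp add: taylor_coeff_def)
    also have "\<dots> = 2 / 3 / of_real (sqrt 3) * (c1 * (- c0 * deriv f 0))"
      by (simp add: b_def d_def)
    also have "\<dots> = of_real y" unfolding c1(2) by (simp add: y_def)
    finally have dg: "deriv g 0 = of_real y" .
    have gz: "g 0 = - of_real (2 / 3 * a)"
      using c0(2) by (simp add: g_def b_def)
    have ngz: "norm (g 0) = 2 / 3 * a"
      unfolding gz norm_minus_cancel norm_of_real using a by simp
    interpret normalized_bloch g q y
    proof
      show "g holomorphic_on ball 0 (sqrt 3)"
        unfolding g_def using dZ
        by (intro holomorphic_intros holomorphic_on_compose_gen[OF _ fhol, unfolded o_def]) auto
      show "norm (g Z) * (3 - (norm Z)\<^sup>2) \<le> 2" if Z: "norm Z < sqrt 3" for Z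
      proof -
        have Z3: "(norm Z)\<^sup>2 < 3" using power_strict_mono[OF Z, of 2] by simp
        have "norm (g Z) = 2 / 3 * norm (f (d * Z))" by (simp add: g_def norm_mult nb)
        also have "\<dots> \<le> 2 / 3 * (1 / (1 - (norm (d * Z))\<^sup>2))"
          using fb[OF dZ[OF Z]] by (intro mult_left_mono) auto
        also have "(norm (d * Z))\<^sup>2 = (norm Z)\<^sup>2 / 3" by (simp add: norm_mult nd power_divide power_mult_distrib)
        also have "2 / 3 * (1 / (1 - (norm Z)\<^sup>2 / 3)) = 2 / (3 - (norm Z)\<^sup>2)" using Z3 by (simp add: field_simps)
        finally show ?thesis using Z3 by (simp add: field_simps)
      qed
      show "g 0 = - of_real (3 * q * (1 - 3 * q\<^sup>2))" unfolding gz qa ..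
    qed (use q q1 dg in \<open>auto simp: y_def\<close>)
    define c where "c k = norm (taylor_coeff g k)" for k
    interpret C: coefficient_bounds c q e
    proof
      show "c 0 = 3 * q * (1 - 3 * q\<^sup>2)"
        unfolding qa by (simp add: c_def taylor_coeff_def ngz)
      show "c 1 = (1 - 3 * q\<^sup>2) * (1 - 9 * q\<^sup>2) - (1 - 3 * q\<^sup>2)\<^sup>2 * e"
        using y_eq y by (simp add: c_def taylor_coeff_def dg K_def)
    qed (use q q1 e_nonneg sum_coefficients_le coefficient_2_le tail_le in \<open>auto simp: c_def\<close>)
    have u: "9 / 4 * C.u = a\<^sup>2"
      unfolding C.u_def C.c0 qa by (simp add: power2_eq_square)
    have term_eq: "real (Suc k) * (norm (taylor_coeff F (Suc k)))\<^sup>2 * r ^ (2 * Suc k)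
      = 9 / 4 * r\<^sup>2 * ((c k)\<^sup>2 * (3 * r\<^sup>2) ^ k / real (Suc k))" for k
    proof -
      have "(c k)\<^sup>2 = 4 / 9 * (1 / 3) ^ k * (norm (taylor_coeff f k))\<^sup>2"
        by (simp add: c_def tg norm_mult norm_power nb nd power_mult_distrib power_divide flip: power_mult)
           (simp add: power_mult mult.commute[of k])
      hence "9 / 4 * r\<^sup>2 * ((c k)\<^sup>2 * (3 * r\<^sup>2) ^ k / real (Suc k))
          = (norm (taylor_coeff f k))\<^sup>2 * (r\<^sup>2 * (r\<^sup>2) ^ k) / real (Suc k)"
        by (simp add: power_mult_distrib power_divide del: of_nat_Suc)
      also have "\<dots> = real (Suc k) * (norm (taylor_coeff F (Suc k)))\<^sup>2 * r ^ (2 * Suc k)"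
        unfolding taylor_coeff_Suc f_def[symmetric] norm_divide power_divide norm_of_nat
        by (simp add: power_mult power2_eq_square del: of_nat_Suc)
      finally show ?thesis ..
    qed
    define t where "t k = real (Suc k) * (norm (taylor_coeff F (Suc k)))\<^sup>2 * r ^ (2 * Suc k)" for k
    have a2: "0 < 1 - a\<^sup>2" using a1 a by (simp add: power_less_one_iff abs_square_less_1)
    have t0: "0 \<le> t k" for k unfolding t_def by (intro mult_nonneg_nonneg zero_le_even_power) auto
    have part: "(\<Sum>k<N. t k) \<le> 27 / 8 * r ^ 4 / (1 - a\<^sup>2)" for N
    proof -
      have "(\<Sum>k<N. t k) * (1 - a\<^sup>2) = 9 / 4 * r\<^sup>2 * ((1 - 9 / 4 * C.u) * (\<Sum>k<N. (c k)\<^sup>2 * (3 * r\<^sup>2) ^ k / real (Suc k)))"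
        unfolding t_def term_eq u by (simp add: sum_distrib_left sum_distrib_right mult_ac)
      also have "\<dots> \<le> 9 / 4 * r\<^sup>2 * (3 * r\<^sup>2 / 2)"
        using C.partial_sum_le[OF s0 s] by (intro mult_left_mono) auto
      also have "\<dots> = 27 / 8 * r ^ 4" by (simp add: power4_eq_xxxx power2_eq_square)
      finally show ?thesis using a2 by (simp only: pos_le_divide_eq)
    qed
    \<comment> \<open>Bounded partial sums give summability, so \<open>suminf\<close> is a genuine
      sum.\<close>
    have "summable t" using t0 part by (rule summableI_nonneg_bounded)
    hence "suminf t \<le> 27 / 8 * r ^ 4 / (1 - a\<^sup>2)" using part by (rule suminf_le_const)
    hence "(1 - a\<^sup>2) * suminf t \<le> 27 / 8 * r ^ 4" using a2 by (simp only: pos_le_divide_eq mult.commute)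
    thus ?thesis by (simp add: bloch_sum_def b1[unfolded One_nat_def] t_def[abs_def])
  qed
qed

section \<open>The critical radius and sharpness\<close>

lemma critical_parameter:
  defines "s0 \<equiv> (59 - sqrt 2713) / 16"
  shows "s0\<^sup>2 = (59 * s0 - 24) / 8" "432 / 1000 \<le> s0" "s0 \<le> 4321 / 10000"
proof -
  have sq: "sqrt 2713 * sqrt 2713 = 2713" by simp
  show "s0\<^sup>2 = (59 * s0 - 24) / 8" unfolding s0_def power2_eq_square using sq by (simp add: field_simps)
  have "sqrt 2713 \<le> 52088 / 1000" by (rule real_le_lsqrt) (auto simp: power2_eq_square)
  thus "432 / 1000 \<le> s0" by (simp add: s0_def)
  have "520864 / 10000 \<le> sqrt 2713" by (rule real_le_rsqrt) (auto simp: power2_eq_square)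
  thus "s0 \<le> 4321 / 10000" by (simp add: s0_def)
qed

text \<open>With \<open>w = sqrt 3 * |z|\<close> the condition reads
  \<open>(w - 1)^2 (w + 2) \<ge> 0\<close>, with equality at
  \<open>|z| = 1 / sqrt 3\<close>.\<close>

lemma quadratic_in_bloch_class: "(\<lambda>z. complex_of_real (3 * sqrt 3 / 4) * z ^ 2) \<in> bloch_class"
proof -
  have d: "deriv (\<lambda>z. complex_of_real (3 * sqrt 3 / 4) * z ^ 2) z = of_real (3 * sqrt 3 / 2) * z" for z
    by (rule DERIV_imp_deriv) (auto intro!: derivative_eq_intros)
  have "norm (complex_of_real (3 * sqrt 3 / 2) * z) \<le> 1 / (1 - (norm z)\<^sup>2)" if z: "z \<in> ball 0 1" for z
  proof -
    define w where "w = sqrt 3 * norm z"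
    have "(w - 1)\<^sup>2 * (w + 2) \<ge> 0" by (intro mult_nonneg_nonneg) (auto simp: w_def)
    moreover have "(w - 1)\<^sup>2 * (w + 2) = w * w\<^sup>2 - 3 * w + 2" by (simp add: power2_eq_square algebra_simps)
    ultimately have "3 / 2 * w - w * w\<^sup>2 / 2 \<le> 1" by simp
    moreover have "w\<^sup>2 = 3 * (norm z)\<^sup>2" by (simp add: w_def power_mult_distrib)
    ultimately have "3 / 2 * w * (1 - (norm z)\<^sup>2) \<le> 1" by (simp add: algebra_simps)
    moreover have "norm (complex_of_real (3 * sqrt 3 / 2) * z) = 3 / 2 * w"
      unfolding norm_mult norm_of_real by (simp add: w_def)
    moreover have "0 < 1 - (norm z)\<^sup>2" using z by (simp add: power_less_one_iff abs_square_less_1)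
    ultimately show ?thesis by (simp add: pos_le_divide_eq)
  qed
  thus ?thesis unfolding bloch_class_def mem_Collect_eq d by (intro conjI ballI holomorphic_intros)
qed

lemma bloch_sum_quadratic: "bloch_sum (\<lambda>z. complex_of_real (3 * sqrt 3 / 4) * z ^ 2) r = 27 / 8 * r ^ 4"
proof -
  define C where "C = complex_of_real (3 * sqrt 3 / 4)"
  have "(\<lambda>z. C * z ^ 2) has_fps_expansion fps_const C * fps_X ^ 2"
    by (intro fps_expansion_intros)
  from fps_nth_fps_expansion[OF this]
  have "taylor_coeff (\<lambda>z. C * z ^ 2) k = fps_nth (fps_const C * fps_X ^ 2) k" for k
    by (simp add: taylor_coeff_def)
  hence tc: "taylor_coeff (\<lambda>z. C * z ^ 2) k = (if k = 2 then C else 0)" for k by simp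
  have C2: "(norm C)\<^sup>2 = 27 / 16"
    unfolding C_def norm_of_real by (simp add: power_divide power_mult_distrib)
  \<comment> \<open>Index \<open>k\<close> carries the coefficient of order \<open>k + 1\<close>, so
    only \<open>k = 1\<close> survives.\<close>
  have "(\<Sum>k. real (Suc k) * (norm (taylor_coeff (\<lambda>z. C * z ^ 2) (Suc k)))\<^sup>2 * r ^ (2 * Suc k))
      = (\<Sum>k\<in>{1}. real (Suc k) * (norm (taylor_coeff (\<lambda>z. C * z ^ 2) (Suc k)))\<^sup>2 * r ^ (2 * Suc k))"
    by (rule suminf_finite) (auto simp: tc)
  also have "\<dots> = 27 / 8 * r ^ 4" by (simp add: tc C2)
  finally show ?thesis unfolding bloch_sum_def C_def[symmetric] by (simp add: tc)
qed

theorem theorem5: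
  defines "R \<equiv> 1 / (4 * sqrt 3) * sqrt (59 - sqrt 2713)"
  shows "(\<forall>F \<in> bloch_class. \<forall>r. R \<le> r \<and> r \<le> 1 / sqrt 3 \<longrightarrow>
            bloch_sum F r \<le> 27 / 8 * r ^ 4)
       \<and> (\<lambda>z. complex_of_real (3 * sqrt 3 / 4) * z ^ 2) \<in> bloch_class
       \<and> (\<forall>r. R \<le> r \<and> r \<le> 1 / sqrt 3 \<longrightarrow>
            bloch_sum (\<lambda>z. complex_of_real (3 * sqrt 3 / 4) * z ^ 2) r = 27 / 8 * r ^ 4)"
proof (intro conjI ballI allI impI)
  fix F r assume F: "F \<in> bloch_class" and r: "R \<le> r \<and> r \<le> 1 / sqrt 3"
  have pos: "0 \<le> 59 - sqrt 2713" using critical_parameter(2) by simp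
  hence R0: "0 \<le> R" by (simp add: R_def)
  \<comment> \<open>The smaller root of \<open>8 s^2 - 59 s + 24\<close>.\<close>
  have "3 * R\<^sup>2 = (59 - sqrt 2713) / 16"
    using pos by (simp add: R_def power_mult_distrib power_divide)
  moreover have "R\<^sup>2 \<le> r\<^sup>2" using r R0 by (intro power_mono) auto
  ultimately have "(59 - sqrt 2713) / 16 \<le> 3 * r\<^sup>2" by linarith
  moreover have "r\<^sup>2 \<le> (1 / sqrt 3)\<^sup>2" using r R0 by (intro power_mono) auto
  hence "3 * r\<^sup>2 \<le> 1" by (simp add: power_divide)
  ultimately show "bloch_sum F r \<le> 27 / 8 * r ^ 4"
    by (rule bloch_sum_le[OF F critical_parameter])
next
  show "(\<lambda>z. complex_of_real (3 * sqrt 3 / 4) * z ^ 2) \<in> bloch_class"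
    by (rule quadratic_in_bloch_class)
next
  fix r show "bloch_sum (\<lambda>z. complex_of_real (3 * sqrt 3 / 4) * z ^ 2) r = 27 / 8 * r ^ 4"
    by (rule bloch_sum_quadratic)
qed

end
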